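(* Let $(t_n)_{n\ge1}$ be a sequence in $[0,1)$ with $\lim_{n\to\infty}t_n=1$. For each $n$ let $w_n$ be a word in $a^{\pm1},b^{\pm1}$ such that, viewed as an element of Thompson's group $F$ via $a=x_0$ and $b=x_1$, $w_n$ has support contained in $[t_n,1]$ and maps $[\frac{3+t_n}{4},1]$ linearly to $[\frac{1+t_n}{2},1]$. Let $$G_n=\langle a,b,c\mid R_1=[ba^{-1},a^{-1}ba],\ R_2=[ba^{-1},a^{-2}ba^2],\ c^{-1}w_n\rangle .$$ Then the sequence of marked groups $(G_n,\{a,b,c\})$ converges in $\mathcal G_3$ to $(G,\{a,b,c\})$, where $$G=\langle a,b,c\mid R_1,\ R_2,\ R_3=[ca^{-1},a^{-1}ca],\ R_4=[ca^{-1},a^{-2}ca^2],\ \text{and } [ba^{-1},a^ica^{-i}]\ \text{for all } i\in\mathbb Z\rangle .$$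
   Context: Thompson's group $F$ is the group of orientation-preserving piecewise-linear homeomorphisms of $[0,1]$ whose breakpoints have dyadic rational coordinates and whose slopes are powers of $2$; the product is composition, $(fg)(t)=f(g(t))$. The support of $f\in F$ is the closure of $\{t: f(t)\neq t\}$. The element $x_0$ maps $[0,\frac12]$, $[\frac12,\frac34]$, $[\frac34,1]$ linearly and increasingly onto $[0,\frac14]$, $[\frac14,\frac12]$, $[\frac12,1]$ respectively. The element $x_1$ is the identity on $[0,\frac12]$ and $x_1(t)=\frac12+\frac12x_0(2t-1)$ on $[\frac12,1]$. $F$ has the presentation $\langle x_0,x_1\mid [x_1x_0^{-1},x_0^{-1}x_1x_0],[x_1x_0^{-1},x_0^{-2}x_1x_0^2]\rangle$, so each $G_n$ is a copy of $F$ with $a=x_0$, $b=x_1$. Here $[x,y]$ denotes the commutator. A marked group $(G,S)$ is a group $G$ with a fixed ordered finite generating set $S$; $\mathcal G_3$ is the set of groups marked by $3$ elements, up to isomorphism of marked groups. Identifying generators of each marked group with a fixed basis of the free group $F_3$ of rank $3$, two marked groups are at distance at most $e^{-R}$ if they have the same relations (words representing the identity) of length at most $R$; convergence is with respect to this topology. Equivalently, $(\Gamma_n,S_n)\to(\Gamma,S)$ if and only if every word $w\in F_3$ trivial in $\Gamma$ is trivial in $\Gamma_n$ for all large $n$, and every $w\in F_3$ trivial in $\Gamma_n$ for infinitely many $n$ is trivial in $\Gamma$. *)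

theory Defs
  imports
    "HOL-Analysis.Analysis"
    "HOL-Algebra.Bij"
    "HOL-Algebra.Generated_Groups"
begin

section \<open>Words and free groups\<close>

text \<open>The letter \<open>(i, True)\<close> stands for the \<open>i\<close>-th generator (counted from 0) and
  \<open>(i, False)\<close> for its formal inverse.  Words need not be reduced.\<close>

type_synonym word = "(nat \<times> bool) list"

definition words :: "nat \<Rightarrow> word set" where
  "words k = lists ({..<k} \<times> UNIV)"

definition winv :: "word \<Rightarrow> word" where
  "winv w = rev (map (\<lambda>(i, e). (i, \<not> e)) w)"

definition wpow :: "word \<Rightarrow> int \<Rightarrow> word" where
  "wpow w i = (if 0 \<le> i then concat (replicate (nat i) w)
               else concat (replicate (nat (- i)) (winv w)))"

definition wcomm :: "word \<Rightarrow> word \<Rightarrow> word" where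
  "wcomm x y = x @ y @ winv x @ winv y"

definition cancellation :: "nat \<Rightarrow> word rel" where
  "cancellation k = {(u @ [(i, e), (i, \<not> e)] @ v, u @ v) | u v i e.
     u \<in> words k \<and> v \<in> words k \<and> i < k}"

definition free_rel :: "nat \<Rightarrow> word rel" where
  "free_rel k = (cancellation k \<union> (cancellation k)\<inverse>)\<^sup>* \<inter> words k \<times> words k"

definition free_group :: "nat \<Rightarrow> word set monoid" where
  "free_group k =
     \<lparr>carrier = words k // free_rel k,
      mult = \<lambda>X Y. free_rel k `` {u @ v | u v. u \<in> X \<and> v \<in> Y},
      one = free_rel k `` {[]}\<rparr>"

primrec word_eval :: "('g, 'm) monoid_scheme \<Rightarrow> 'g list \<Rightarrow> word \<Rightarrow> 'g" where
  "word_eval G S [] = \<one>\<^bsub>G\<^esub>"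
| "word_eval G S (x # w) =
     (if snd x then S ! fst x else inv\<^bsub>G\<^esub> (S ! fst x)) \<otimes>\<^bsub>G\<^esub> word_eval G S w"

lemma words_simps [simp]:
  "[] \<in> words k"
  "x # w \<in> words k \<longleftrightarrow> fst x < k \<and> w \<in> words k"
  "u @ v \<in> words k \<longleftrightarrow> u \<in> words k \<and> v \<in> words k"
  by (cases x; auto simp: words_def)+

lemma winv_simps [simp]:
  "winv [] = []" "winv ((i, e) # w) = winv w @ [(i, \<not> e)]"
  "winv (u @ v) = winv v @ winv u" "winv (winv w) = w"
  by (auto simp: winv_def rev_map o_def split_def)

lemma winv_words [simp]: "winv w \<in> words k \<longleftrightarrow> w \<in> words k"
  by (induction w) auto

lemma equiv_free_rel: "equiv (words k) (free_rel k)"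
proof -
  have "sym ((cancellation k \<union> (cancellation k)\<inverse>)\<^sup>*)"
    by (intro sym_rtrancl) (auto simp: sym_def)
  then show ?thesis
    unfolding free_rel_def
    by (intro equivI) (auto simp: refl_on_def sym_def trans_def)
qed

lemma free_rel_context:
  assumes "(u, v) \<in> free_rel k" "p \<in> words k" "q \<in> words k"
  shows "(p @ u @ q, p @ v @ q) \<in> free_rel k"
proof -
  have "(u, v) \<in> (cancellation k \<union> (cancellation k)\<inverse>)\<^sup>*"
    using assms(1) by (simp add: free_rel_def)
  then have "(p @ u @ q, p @ v @ q) \<in> (cancellation k \<union> (cancellation k)\<inverse>)\<^sup>*"
  proof (induction rule: rtrancl_induct)
    case (step y z)
    have "(p @ y @ q, p @ z @ q) \<in> cancellation k" if "(y, z) \<in> cancellation k" for y z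
    proof -
      obtain a b i e where
        "y = a @ [(i, e), (i, \<not> e)] @ b" "z = a @ b" "a \<in> words k" "b \<in> words k" "i < k"
        using \<open>(y, z) \<in> cancellation k\<close> unfolding cancellation_def by blast
      then show ?thesis
        using assms(2,3) unfolding cancellation_def mem_Collect_eq
        by (intro exI[of _ "p @ a"] exI[of _ "b @ q"] exI[of _ i] exI[of _ e]) auto
    qed
    then have "(p @ y @ q, p @ z @ q) \<in> cancellation k \<union> (cancellation k)\<inverse>"
      using step.hyps(2) by blast
    with step.IH show ?case
      by (meson rtrancl.rtrancl_into_rtrancl)
  qed simp
  then show ?thesis
    using assms by (auto simp: free_rel_def)
qed

lemma free_rel_append:
  assumes "(u, u') \<in> free_rel k" "(v, v') \<in> free_rel k"
  shows "(u @ v, u' @ v') \<in> free_rel k"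
proof -
  have w: "u \<in> words k" "u' \<in> words k" "v \<in> words k" "v' \<in> words k"
    using assms by (auto simp: free_rel_def)
  have "(u @ v, u' @ v) \<in> free_rel k"
    using free_rel_context[OF assms(1), of "[]" v] w by simp
  moreover have "(u' @ v, u' @ v') \<in> free_rel k"
    using free_rel_context[OF assms(2), of u' "[]"] w by simp
  ultimately show ?thesis
    using equiv_free_rel[of k] by (meson equivE transE)
qed

lemma free_rel_refl: "w \<in> words k \<Longrightarrow> (w, w) \<in> free_rel k"
  by (simp add: free_rel_def)

lemma mult_free_group:
  assumes "u \<in> words k" "v \<in> words k"
  shows "free_rel k `` {u} \<otimes>\<^bsub>free_group k\<^esub> free_rel k `` {v} = free_rel k `` {u @ v}"
proof -
  have "free_rel k `` {x @ y |x y. (u, x) \<in> free_rel k \<and> (v, y) \<in> free_rel k}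
      = free_rel k `` {u @ v}" (is "?L = ?R")
  proof
    show "?L \<subseteq> ?R"
    proof
      fix z assume "z \<in> ?L"
      then obtain x y where "(u, x) \<in> free_rel k" "(v, y) \<in> free_rel k" "(x @ y, z) \<in> free_rel k"
        by auto
      then show "z \<in> ?R"
        using free_rel_append[of u x k v y] equiv_free_rel[of k]
        by (meson ImageI equivE insertI1 transE)
    qed
    show "?R \<subseteq> ?L"
      using free_rel_refl assms by blast
  qed
  then show ?thesis
    by (simp add: free_group_def)
qed

lemma free_rel_winv: "w \<in> words k \<Longrightarrow> (winv w @ w, []) \<in> free_rel k"
proof (induction w)
  case (Cons x w)
  obtain i e where x: "x = (i, e)"
    by (cases x)
  have "(winv w @ [(i, \<not> e), (i, \<not> \<not> e)] @ w, winv w @ w) \<in> cancellation k"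
    using Cons.prems x unfolding cancellation_def mem_Collect_eq
    by (intro exI[of _ "winv w"] exI[of _ w] exI[of _ i] exI[of _ "\<not> e"]) auto
  then have "(winv (x # w) @ x # w, winv w @ w) \<in> free_rel k"
    using Cons.prems x by (auto simp: free_rel_def)
  with Cons show ?case
    using equiv_free_rel[of k] by (meson equivE transE words_simps(2))
qed (simp add: free_rel_def)

lemma carrier_free_group: "carrier (free_group k) = (\<lambda>w. free_rel k `` {w}) ` words k"
  by (auto simp: free_group_def quotient_def)

lemma one_free_group: "\<one>\<^bsub>free_group k\<^esub> = free_rel k `` {[]}"
  by (simp add: free_group_def)

lemma group_free_group: "group (free_group k)"
proof (rule groupI)
  fix x assume "x \<in> carrier (free_group k)"
  then obtain w where w: "w \<in> words k" "x = free_rel k `` {w}"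
    by (auto simp: carrier_free_group)
  show "\<exists>y\<in>carrier (free_group k). y \<otimes>\<^bsub>free_group k\<^esub> x = \<one>\<^bsub>free_group k\<^esub>"
  proof
    have "free_rel k `` {winv w @ w} = free_rel k `` {[]}"
      by (rule equiv_class_eq[OF equiv_free_rel free_rel_winv[OF w(1)]])
    then show "free_rel k `` {winv w} \<otimes>\<^bsub>free_group k\<^esub> x = \<one>\<^bsub>free_group k\<^esub>"
      using w by (simp add: mult_free_group one_free_group)
    show "free_rel k `` {winv w} \<in> carrier (free_group k)"
      using w by (simp add: carrier_free_group)
  qed
qed (auto simp: carrier_free_group one_free_group mult_free_group)


section \<open>Marked groups and group presentations\<close>

text \<open>A group marked by \<open>k\<close> elements; repetitions in the list of generators are allowed.\<close>

type_synonym 'g marked = "'g monoid \<times> 'g list"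

definition marked_groups :: "nat \<Rightarrow> 'g marked set" where
  "marked_groups k = {(G, S). group G \<and> length S = k \<and> set S \<subseteq> carrier G \<and>
     generate G (set S) = carrier G}"

definition marked_iso :: "nat \<Rightarrow> 'g marked rel" where
  "marked_iso k = {((G, S), (H, T)) \<in> marked_groups k \<times> marked_groups k.
     \<exists>\<phi> \<in> iso G H. map \<phi> S = T}"

definition marked_relations :: "nat \<Rightarrow> 'g marked \<Rightarrow> word set" where
  "marked_relations k M =
     {w \<in> words k. word_eval (fst M) (snd M) w = \<one>\<^bsub>fst M\<^esub>}"

definition marked_dist :: "nat \<Rightarrow> 'g marked \<Rightarrow> 'g marked \<Rightarrow> real" where
  "marked_dist k M N = Inf {exp (- real R) | R :: nat.
     \<forall>w. length w \<le> R \<longrightarrow> w \<in> marked_relations k M \<longleftrightarrow> w \<in> marked_relations k N}"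

text \<open>The space of groups marked by \<open>k\<close> elements, up to isomorphism of marked groups.
  The type \<open>'g\<close> of group elements is fixed; for \<open>'g = word set set\<close> every marked group is
  represented, by a quotient of the free group.\<close>

definition marked_space :: "nat \<Rightarrow> 'g marked set set" where
  "marked_space k = marked_groups k // marked_iso k"

text \<open>Isomorphic marked groups have the same relations, so the choice of representatives
  is immaterial.\<close>

definition marked_space_dist :: "nat \<Rightarrow> 'g marked set \<Rightarrow> 'g marked set \<Rightarrow> real" where
  "marked_space_dist k X Y = marked_dist k (SOME M. M \<in> X) (SOME N. N \<in> Y)"

definition marked_topology :: "nat \<Rightarrow> 'g marked set topology" where
  "marked_topology k = Metric_space.mtopology (marked_space k) (marked_space_dist k)"

definition marked_class :: "nat \<Rightarrow> 'g marked \<Rightarrow> 'g marked set" where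
  "marked_class k M = marked_iso k `` {M}"

definition normal_closure :: "('g, 'm) monoid_scheme \<Rightarrow> 'g set \<Rightarrow> 'g set" where
  "normal_closure G A =
     generate G {g \<otimes>\<^bsub>G\<^esub> x \<otimes>\<^bsub>G\<^esub> inv\<^bsub>G\<^esub> g | g x. g \<in> carrier G \<and> x \<in> A}"

definition presented_group :: "nat \<Rightarrow> word set \<Rightarrow> word set set marked" where
  "presented_group k R =
    (let F = free_group k; N = normal_closure F ((\<lambda>r. free_rel k `` {r}) ` R)
     in (F Mod N, map (\<lambda>i. N #>\<^bsub>F\<^esub> free_rel k `` {[(i, True)]}) [0..<k]))"

lemma normal_closure_normal:
  fixes G (structure)
  assumes "group G" "A \<subseteq> carrier G"
  shows "normal_closure G A \<lhd> G"
proof -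
  interpret group G by fact
  show ?thesis
    unfolding normal_closure_def
  proof (rule normal_generateI)
    show "{g \<otimes> x \<otimes> inv g |g x. g \<in> carrier G \<and> x \<in> A} \<subseteq> carrier G"
      using assms(2) by auto
    fix h g
    assume "h \<in> {g \<otimes> x \<otimes> inv g |g x. g \<in> carrier G \<and> x \<in> A}" and g: "g \<in> carrier G"
    then obtain a x where h: "h = a \<otimes> x \<otimes> inv a" and a: "a \<in> carrier G" and x: "x \<in> A"
      by auto
    have "x \<in> carrier G"
      using x assms(2) by blast
    then have "g \<otimes> h \<otimes> inv g = (g \<otimes> a) \<otimes> x \<otimes> inv (g \<otimes> a)"
      using h a g by (simp add: m_assoc inv_mult_group)
    then show "g \<otimes> h \<otimes> inv g \<in> {g \<otimes> x \<otimes> inv g |g x. g \<in> carrier G \<and> x \<in> A}"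
      using a g x by blast
  qed
qed

lemma (in group) word_eval_closed:
  assumes "length S = k" "set S \<subseteq> carrier G" "w \<in> words k"
  shows "word_eval G S w \<in> carrier G"
  using assms(3)
proof (induction w)
  case (Cons x w)
  then have "S ! fst x \<in> carrier G"
    using assms by (metis nth_mem subsetD words_simps(2))
  with Cons show ?case
    by simp
qed simp

lemma (in group) word_eval_append:
  assumes "length S = k" "set S \<subseteq> carrier G" "u \<in> words k" "v \<in> words k"
  shows "word_eval G S (u @ v) = word_eval G S u \<otimes> word_eval G S v"
  using assms(3)
proof (induction u)
  case Nil
  then show ?case
    using assms word_eval_closed by simp
next
  case (Cons x w)
  then have "S ! fst x \<in> carrier G"
    using assms by (metis nth_mem subsetD words_simps(2))
  with Cons show ?case
    using word_eval_closed[OF assms(1,2)] assms(4) by (simp add: m_assoc)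
qed

lemma (in group) word_eval_winv:
  assumes "length S = k" "set S \<subseteq> carrier G" "w \<in> words k"
  shows "word_eval G S (winv w) = inv (word_eval G S w)"
  using assms(3)
proof (induction w)
  case (Cons x w)
  obtain i e where x: "x = (i, e)"
    by (cases x)
  have "S ! i \<in> carrier G"
    using assms Cons.prems x by (metis fst_conv nth_mem subsetD words_simps(2))
  with Cons x show ?case
    using word_eval_closed[OF assms(1,2)]
    by (auto simp: word_eval_append[OF assms(1,2)] inv_mult_group)
qed simp

lemma (in group) generate_eq_word_eval:
  assumes "length S = k" "set S \<subseteq> carrier G"
  shows "generate G (set S) = word_eval G S ` words k"
proof
  show "generate G (set S) \<subseteq> word_eval G S ` words k"
  proof
    fix g assume "g \<in> generate G (set S)"
    then show "g \<in> word_eval G S ` words k"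
    proof induction
      case one
      show ?case
        by (rule image_eqI[of _ _ "[]"]) auto
    next
      case (incl h)
      then obtain i where "i < k" "h = S ! i"
        using assms(1) by (metis in_set_conv_nth)
      moreover from this have "h \<in> carrier G"
        using assms by auto
      ultimately show ?case
        by (intro image_eqI[of _ _ "[(i, True)]"]) auto
    next
      case (inv h)
      then obtain i where "i < k" "h = S ! i"
        using assms(1) by (metis in_set_conv_nth)
      moreover from this have "h \<in> carrier G"
        using assms by auto
      ultimately show ?case
        by (intro image_eqI[of _ _ "[(i, False)]"]) auto
    next
      case (eng h1 h2)
      then obtain u v where "h1 = word_eval G S u" "h2 = word_eval G S v"
        "u \<in> words k" "v \<in> words k"
        by blast
      then show ?case
        using word_eval_append[OF assms] by (intro image_eqI[of _ _ "u @ v"]) auto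
    qed
  qed
  show "word_eval G S ` words k \<subseteq> generate G (set S)"
  proof clarify
    fix w assume "w \<in> words k"
    then show "word_eval G S w \<in> generate G (set S)"
    proof (induction w)
      case (Cons x w)
      then have "S ! fst x \<in> set S"
        using assms(1) by simp
      with Cons show ?case
        by (auto intro: generate.eng generate.incl generate.inv)
    qed (simp add: generate.one)
  qed
qed

lemma marked_groupsD:
  assumes "(G, S) \<in> marked_groups k"
  shows "group G" "length S = k" "set S \<subseteq> carrier G" "carrier G = word_eval G S ` words k"
proof -
  show *: "group G" "length S = k" "set S \<subseteq> carrier G"
    using assms by (auto simp: marked_groups_def)
  have "generate G (set S) = carrier G"
    using assms by (auto simp: marked_groups_def)
  with group.generate_eq_word_eval[OF *] show "carrier G = word_eval G S ` words k"
    by simp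
qed

lemma word_eval_hom:
  assumes "group G" "group H" "\<phi> \<in> hom G H" "length S = k" "set S \<subseteq> carrier G" "w \<in> words k"
  shows "word_eval H (map \<phi> S) w = \<phi> (word_eval G S w)"
  using assms(6)
proof (induction w)
  case Nil
  then show ?case
    using assms hom_one by force
next
  case (Cons x w)
  interpret group_hom G H \<phi>
    using assms by (simp add: group_hom_def group_hom_axioms_def)
  have "S ! fst x \<in> carrier G" "fst x < length S"
    using assms Cons.prems by (metis nth_mem subsetD words_simps(2))+
  moreover have "word_eval G S w \<in> carrier G"
    using G.word_eval_closed[OF assms(4,5)] Cons.prems by simp
  ultimately show ?case
    using Cons by auto
qed

lemma presented_group_marked:
  assumes "R \<subseteq> words k"
  shows "presented_group k R \<in> marked_groups k"
proof -
  define F where "F = free_group k"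
  define N where "N = normal_closure F ((\<lambda>r. free_rel k `` {r}) ` R)"
  define g where "g = (\<lambda>i. free_rel k `` {[(i, True)]})"
  define S where "S = map g [0..<k]"
  define T where "T = map (\<lambda>x. N #>\<^bsub>F\<^esub> x) S"
  interpret F: group F
    unfolding F_def by (rule group_free_group)
  have "N \<lhd> F"
    unfolding N_def using assms
    by (intro normal_closure_normal F.is_group) (auto simp: F_def carrier_free_group)
  then interpret N: normal N F .
  interpret Q: group "F Mod N"
    by (rule N.factorgroup_is_group)
  have S: "length S = k" "set S \<subseteq> carrier F"
    by (auto simp: S_def g_def F_def carrier_free_group)
  have inv: "inv\<^bsub>F\<^esub> (g i) = free_rel k `` {[(i, False)]}" if "i < k" for i
  proof (rule F.inv_equality)
    have "free_rel k `` {[(i, False), (i, True)]} = free_rel k `` {[]}"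
      using free_rel_winv[of "[(i, True)]" k] that
      by (intro equiv_class_eq[OF equiv_free_rel]) simp
    then show "free_rel k `` {[(i, False)]} \<otimes>\<^bsub>F\<^esub> g i = \<one>\<^bsub>F\<^esub>"
      using that by (simp add: F_def g_def mult_free_group one_free_group)
  qed (use that in \<open>auto simp: g_def F_def carrier_free_group\<close>)
  have ev: "word_eval F S w = free_rel k `` {w}" if "w \<in> words k" for w
    using that
  proof (induction w)
    case Nil
    then show ?case
      by (simp add: F_def one_free_group)
  next
    case (Cons x w)
    have "(if snd x then S ! fst x else inv\<^bsub>F\<^esub> (S ! fst x)) = free_rel k `` {[x]}"
      using Cons.prems inv by (cases x) (simp add: S_def g_def)
    then have "word_eval F S (x # w) = free_rel k `` {[x]} \<otimes>\<^bsub>F\<^esub> free_rel k `` {w}"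
      using Cons by simp
    then show ?case
      using Cons.prems by (simp add: F_def mult_free_group)
  qed
  have hom: "(\<lambda>x. N #>\<^bsub>F\<^esub> x) \<in> hom F (F Mod N)"
    by (rule N.r_coset_hom_Mod)
  have T: "length T = k" "set T \<subseteq> carrier (F Mod N)"
    using S by (auto simp: T_def carrier_FactGroup)
  have "word_eval (F Mod N) T ` words k = (\<lambda>w. N #>\<^bsub>F\<^esub> (free_rel k `` {w})) ` words k"
    unfolding T_def
    using word_eval_hom[OF F.is_group Q.is_group hom S] ev by (intro image_cong) auto
  also have "\<dots> = carrier (F Mod N)"
    by (auto simp: carrier_FactGroup carrier_free_group F_def)
  finally have "generate (F Mod N) (set T) = carrier (F Mod N)"
    using Q.generate_eq_word_eval[OF T] by simp
  then have "(F Mod N, T) \<in> marked_groups k"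
    using T Q.is_group by (simp add: marked_groups_def)
  moreover have "presented_group k R = (F Mod N, T)"
    by (simp add: presented_group_def Let_def F_def N_def T_def S_def g_def)
  ultimately show ?thesis
    by simp
qed

lemma marked_iso_iff:
  assumes "M \<in> marked_groups k" "N \<in> marked_groups k"
  shows "(M, N) \<in> marked_iso k \<longleftrightarrow> marked_relations k M = marked_relations k N"
proof -
  obtain G S H T where MN: "M = (G, S)" "N = (H, T)"
    by (cases M, cases N)
  note G = marked_groupsD[OF assms(1)[unfolded MN]]
  note H = marked_groupsD[OF assms(2)[unfolded MN]]
  interpret G: group G by fact
  interpret H: group H by fact
  show ?thesis
  proof
    assume "(M, N) \<in> marked_iso k"
    then obtain \<phi> where \<phi>: "\<phi> \<in> iso G H" "map \<phi> S = T"
      by (auto simp: marked_iso_def MN)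
    have hom: "\<phi> \<in> hom G H" and inj: "inj_on \<phi> (carrier G)"
      using \<phi>(1) by (auto simp: iso_def bij_betw_def)
    have "word_eval H T w = \<one>\<^bsub>H\<^esub> \<longleftrightarrow> word_eval G S w = \<one>\<^bsub>G\<^esub>" if w: "w \<in> words k" for w
    proof -
      have "word_eval H T w = \<phi> (word_eval G S w)"
        using word_eval_hom[OF G(1) H(1) hom G(2,3) w] \<phi>(2) by simp
      moreover have "\<phi> \<one>\<^bsub>G\<^esub> = \<one>\<^bsub>H\<^esub>"
        using hom_one[OF hom G(1) H(1)] .
      ultimately show ?thesis
        using inj_on_eq_iff[OF inj G.word_eval_closed[OF G(2,3) w] G.one_closed] by simp
    qed
    then show "marked_relations k M = marked_relations k N"
      by (auto simp: marked_relations_def MN)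
  next
    assume rel: "marked_relations k M = marked_relations k N"
    have eq: "word_eval G S u = word_eval G S v \<longleftrightarrow> word_eval H T u = word_eval H T v"
      if uv: "u \<in> words k" "v \<in> words k" for u v
    proof -
      have "word_eval G S u = word_eval G S v \<longleftrightarrow> word_eval G S (u @ winv v) = \<one>\<^bsub>G\<^esub>"
        using uv G.word_eval_closed[OF G(2,3)]
        by (simp add: G.word_eval_append[OF G(2,3)] G.word_eval_winv[OF G(2,3)]
            G.inv_solve_right')
      moreover have "word_eval H T u = word_eval H T v \<longleftrightarrow> word_eval H T (u @ winv v) = \<one>\<^bsub>H\<^esub>"
        using uv H.word_eval_closed[OF H(2,3)]
        by (simp add: H.word_eval_append[OF H(2,3)] H.word_eval_winv[OF H(2,3)]
            H.inv_solve_right')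
      moreover have "u @ winv v \<in> marked_relations k M \<longleftrightarrow> u @ winv v \<in> marked_relations k N"
        using rel by simp
      ultimately show ?thesis
        using uv by (simp add: marked_relations_def MN)
    qed
    define \<phi> where "\<phi> g = word_eval H T (SOME w. w \<in> words k \<and> word_eval G S w = g)" for g
    have \<phi>: "\<phi> (word_eval G S w) = word_eval H T w" if "w \<in> words k" for w
    proof -
      have "\<exists>v. v \<in> words k \<and> word_eval G S v = word_eval G S w"
        using that by blast
      from someI_ex[OF this] show ?thesis
        using eq that unfolding \<phi>_def by blast
    qed
    have "\<phi> \<in> hom G H"
    proof (rule homI)
      fix x assume "x \<in> carrier G"
      then show "\<phi> x \<in> carrier H"
        using \<phi> unfolding G(4) H(4) by auto
    next
      fix x y assume "x \<in> carrier G" "y \<in> carrier G"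
      then obtain u v where "u \<in> words k" "v \<in> words k" "x = word_eval G S u" "y = word_eval G S v"
        unfolding G(4) by blast
      then show "\<phi> (x \<otimes>\<^bsub>G\<^esub> y) = \<phi> x \<otimes>\<^bsub>H\<^esub> \<phi> y"
        using \<phi>[of "u @ v"] \<phi>
        by (simp add: G.word_eval_append[OF G(2,3)] H.word_eval_append[OF H(2,3)])
    qed
    moreover have "inj_on \<phi> (carrier G)"
      unfolding G(4) using \<phi> eq by (auto intro!: inj_onI)
    moreover have "\<phi> ` carrier G = carrier H"
      unfolding G(4) H(4) using \<phi> by (auto simp: image_image)
    ultimately have "\<phi> \<in> iso G H"
      by (simp add: iso_def bij_betw_def)
    moreover have "map \<phi> S = T"
    proof (rule nth_equalityI)
      fix i assume "i < length (map \<phi> S)"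
      then have i: "i < k"
        using G(2) by simp
      then have "S ! i \<in> carrier G" "T ! i \<in> carrier H"
        using G(2,3) H(2,3) by (metis nth_mem subsetD)+
      then show "map \<phi> S ! i = T ! i"
        using \<phi>[of "[(i, True)]"] i G(2) by simp
    qed (use G(2) H(2) in simp)
    ultimately show "(M, N) \<in> marked_iso k"
      using assms by (auto simp: marked_iso_def MN)
  qed
qed

lemma equiv_marked_iso: "equiv (marked_groups k) (marked_iso k)"
proof -
  have "marked_iso k = {(M, N). M \<in> marked_groups k \<and> N \<in> marked_groups k \<and>
      marked_relations k M = marked_relations k N}"
    using marked_iso_iff by (fastforce simp: marked_iso_def)
  then show ?thesis
    by (auto intro!: equivI simp: refl_on_def sym_def trans_def)
qed

lemma marked_dist_le_iff:
  "marked_dist k M N \<le> exp (- real R) \<longleftrightarrow>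
     (\<forall>w. length w \<le> R \<longrightarrow> w \<in> marked_relations k M \<longleftrightarrow> w \<in> marked_relations k N)"
  (is "_ \<longleftrightarrow> ?P R")
proof
  have bdd: "bdd_below {exp (- real R) | R. ?P R}"
    by (rule bdd_belowI[of _ 0]) auto
  show "marked_dist k M N \<le> exp (- real R)" if "?P R"
    unfolding marked_dist_def using that by (intro cInf_lower[OF _ bdd]) auto
  show "?P R" if "marked_dist k M N \<le> exp (- real R)"
  proof (rule ccontr)
    assume R: "\<not> ?P R"
    have "?P 0"
      by (auto simp: marked_relations_def)
    then have ne: "{exp (- real R) | R. ?P R} \<noteq> {}"
      by blast
    obtain R' where R': "R = Suc R'"
      using R \<open>?P 0\<close> by (cases R) auto
    have "exp (- real R') \<le> marked_dist k M N"
      unfolding marked_dist_def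
    proof (rule cInf_greatest[OF ne])
      fix x assume "x \<in> {exp (- real R) | R. ?P R}"
      then obtain Q where Q: "x = exp (- real Q)" "?P Q"
        by blast
      have "Q < R"
        using Q(2) R by (meson leI le_trans)
      then show "exp (- real R') \<le> x"
        using Q(1) R' by simp
    qed
    also have "\<dots> \<le> exp (- real (Suc R'))"
      using that R' by simp
    finally show False
      by simp
  qed
qed

lemma marked_dist_nonneg: "0 \<le> marked_dist k M N"
  unfolding marked_dist_def
  by (rule cInf_greatest) (auto intro: exI[of _ "0 :: nat"] simp: marked_relations_def)

lemma marked_dist_commute: "marked_dist k M N = marked_dist k N M"
  unfolding marked_dist_def by metis

lemma marked_dist_eq_0_iff:
  "marked_dist k M N = 0 \<longleftrightarrow> marked_relations k M = marked_relations k N"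
proof
  assume "marked_dist k M N = 0"
  then have "w \<in> marked_relations k M \<longleftrightarrow> w \<in> marked_relations k N" for w
    using marked_dist_le_iff[of k M N "length w"] by simp
  then show "marked_relations k M = marked_relations k N"
    by blast
next
  assume "marked_relations k M = marked_relations k N"
  then have le: "marked_dist k M N \<le> exp (- real R)" for R
    by (simp add: marked_dist_le_iff)
  have "(\<lambda>R. exp (- real R)) \<longlonglongrightarrow> 0"
    by (intro filterlim_compose[OF exp_at_bot] filterlim_uminus_at_bot_at_top[THEN filterlim_compose]
        filterlim_real_sequentially)
  then have "marked_dist k M N \<le> 0"
    using le by (intro LIMSEQ_le_const) auto
  then show "marked_dist k M N = 0"
    using marked_dist_nonneg[of k M N] by simp
qed

lemma marked_dist_cases:
  "marked_relations k M = marked_relations k N \<or> (\<exists>R :: nat. marked_dist k M N = exp (- real R))"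
proof (rule disjCI)
  assume ne: "\<not> (\<exists>R :: nat. marked_dist k M N = exp (- real R))"
  have "marked_dist k M N \<le> exp (- real R)" for R
  proof (induction R)
    case 0
    then show ?case
      unfolding marked_dist_le_iff by (auto simp: marked_relations_def)
  next
    case (Suc R)
    have *: "exp (- real R) \<le> marked_dist k M N" if "\<not> marked_dist k M N \<le> exp (- real (Suc R))"
      unfolding marked_dist_def
    proof (rule cInf_greatest)
      fix x assume "x \<in> {exp (- real R) | R.
        \<forall>w. length w \<le> R \<longrightarrow> w \<in> marked_relations k M \<longleftrightarrow> w \<in> marked_relations k N}"
      then obtain Q where Q: "x = exp (- real Q)" "marked_dist k M N \<le> exp (- real Q)"
        unfolding marked_dist_le_iff by blast
      have "Q < Suc R"
      proof (rule ccontr)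
        assume "\<not> Q < Suc R"
        then have "exp (- real Q) \<le> exp (- real (Suc R))"
          by simp
        with Q(2) that show False
          by linarith
      qed
      then show "exp (- real R) \<le> x"
        using Q(1) by simp
    qed (use Suc in \<open>auto simp: marked_dist_le_iff\<close>)
    show ?case
      using * Suc ne by (metis order_antisym)
  qed
  then have "w \<in> marked_relations k M \<longleftrightarrow> w \<in> marked_relations k N" for w
    using marked_dist_le_iff[of k M N "length w"] by simp
  then show "marked_relations k M = marked_relations k N"
    by blast
qed

lemma marked_dist_triangle: "marked_dist k M P \<le> marked_dist k M N + marked_dist k N P"
proof -
  consider "marked_relations k M = marked_relations k N"
    | "marked_relations k N = marked_relations k P"
    | R Q :: nat where "marked_dist k M N = exp (- real R)" "marked_dist k N P = exp (- real Q)"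
    using marked_dist_cases by metis
  then show ?thesis
  proof cases
    case 1
    then have "marked_dist k M P = marked_dist k N P"
      by (simp add: marked_dist_def)
    then show ?thesis
      using marked_dist_nonneg[of k M N] by simp
  next
    case 2
    then have "marked_dist k M P = marked_dist k M N"
      by (simp add: marked_dist_def)
    then show ?thesis
      using marked_dist_nonneg[of k N P] by simp
  next
    case 3
    then have "marked_dist k M N \<le> exp (- real (min R Q))" "marked_dist k N P \<le> exp (- real (min R Q))"
      by simp_all
    then have "marked_dist k M P \<le> exp (- real (min R Q))"
      unfolding marked_dist_le_iff by simp
    also have "\<dots> \<le> exp (- real R) + exp (- real Q)"
      by (simp add: min_def add_increasing add_increasing2)
    finally show ?thesis
      using 3 by simp
  qed
qed

lemma Metric_space_marked: "Metric_space (marked_space k) (marked_space_dist k)"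
proof
  fix X Y :: "'a marked set"
  have rep: "(SOME M. M \<in> Z) \<in> marked_groups k \<and> Z = marked_class k (SOME M. M \<in> Z)"
    if "Z \<in> marked_space k" for Z :: "'a marked set"
  proof -
    define M where "M = (SOME M. M \<in> Z)"
    obtain N where N: "N \<in> marked_groups k" "Z = marked_iso k `` {N}"
      using \<open>Z \<in> marked_space k\<close> unfolding marked_space_def by (rule quotientE)
    have "N \<in> Z"
      using N equiv_class_self[OF equiv_marked_iso] by blast
    then have "M \<in> Z"
      unfolding M_def by (rule someI)
    then have "(N, M) \<in> marked_iso k"
      using N by blast
    then have "Z = marked_class k M"
      using N(2) equiv_class_eq[OF equiv_marked_iso] unfolding marked_class_def by metis
    moreover have "M \<in> marked_groups k"
      using \<open>(N, M) \<in> marked_iso k\<close> by (auto simp: marked_iso_def)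
    ultimately have "M \<in> marked_groups k" "Z = marked_class k M"
      by blast+
    then show ?thesis
      unfolding M_def by (rule conjI)
  qed
  assume XY: "X \<in> marked_space k" "Y \<in> marked_space k"
  define M N where "M = (SOME M. M \<in> X)" and "N = (SOME N. N \<in> Y)"
  have MN: "M \<in> marked_groups k" "N \<in> marked_groups k" "X = marked_class k M" "Y = marked_class k N"
    using rep[OF XY(1)] rep[OF XY(2)] unfolding M_def N_def by blast+
  have "marked_space_dist k X Y = marked_dist k M N"
    by (simp add: marked_space_dist_def M_def N_def)
  then have "marked_space_dist k X Y = 0 \<longleftrightarrow> (M, N) \<in> marked_iso k"
    by (simp add: marked_dist_eq_0_iff marked_iso_iff[OF MN(1,2)])
  also have "\<dots> \<longleftrightarrow> X = Y"
    using eq_equiv_class_iff[OF equiv_marked_iso MN(1,2)] MN(3,4) by (simp add: marked_class_def)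
  finally show "marked_space_dist k X Y = 0 \<longleftrightarrow> X = Y" .
next
  fix X Y Z :: "'a marked set"
  show "marked_space_dist k X Z \<le> marked_space_dist k X Y + marked_space_dist k Y Z"
    unfolding marked_space_dist_def by (rule marked_dist_triangle)
qed (auto simp: marked_space_dist_def marked_dist_nonneg intro: marked_dist_commute)


section \<open>Thompson's group\<close>

definition dyadic :: "real set" where
  "dyadic = {real_of_int m / 2 ^ n | m n. True}"

text \<open>\<open>P\<close> contains the abscissae of the breakpoints, and possibly further dyadic points.\<close>

definition dyadic_piecewise_linear :: "(real \<Rightarrow> real) \<Rightarrow> bool" where
  "dyadic_piecewise_linear f \<longleftrightarrow>
     (\<exists>P. finite P \<and> {0, 1} \<subseteq> P \<and> P \<subseteq> {0..1} \<inter> dyadic \<and> f ` P \<subseteq> dyadic \<and>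
        (\<forall>p\<in>P. \<forall>q\<in>P. p < q \<and> P \<inter> {p<..<q} = {} \<longrightarrow>
           (\<exists>(k :: int) d. \<forall>t\<in>{p..q}. f t = 2 powi k * t + d)))"

text \<open>Multiplication in \<open>BijGroup\<close> is composition, the right factor being applied first.\<close>

definition thompson_F :: "(real \<Rightarrow> real) monoid" where
  "thompson_F = BijGroup {0..1} \<lparr>carrier :=
     {f \<in> extensional {0..1}. (\<exists>g. homeomorphism {0..1} {0..1} f g) \<and>
        strict_mono_on {0..1} f \<and> dyadic_piecewise_linear f}\<rparr>"

definition thompson_x0 :: "real \<Rightarrow> real" where
  "thompson_x0 = (\<lambda>t\<in>{0..1}.
     if t \<le> 1/2 then t / 2 else if t \<le> 3/4 then t - 1/4 else 2 * t - 1)"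

definition thompson_x1 :: "real \<Rightarrow> real" where
  "thompson_x1 = (\<lambda>t\<in>{0..1}.
     if t \<le> 1/2 then t else 1/2 + thompson_x0 (2 * t - 1) / 2)"

definition thompson_support :: "(real \<Rightarrow> real) \<Rightarrow> real set" where
  "thompson_support f = closure {t \<in> {0..1}. f t \<noteq> t}"

definition maps_linearly_onto :: "(real \<Rightarrow> real) \<Rightarrow> real set \<Rightarrow> real set \<Rightarrow> bool" where
  "maps_linearly_onto f I J \<longleftrightarrow> (\<exists>m c. \<forall>t\<in>I. f t = m * t + c) \<and> f ` I = J"

text \<open>The element of Thompson's group represented by a word in \<open>a\<close>, \<open>b\<close> (letters 0 and 1).\<close>

definition thompson_eval :: "word \<Rightarrow> real \<Rightarrow> real" where
  "thompson_eval w = word_eval thompson_F [thompson_x0, thompson_x1] w"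

lemma dyadic_cell:
  assumes "finite P" "{0, 1} \<subseteq> P" "t \<in> {0..1 :: real}"
  obtains p q where "p \<in> P" "q \<in> P" "p < q" "P \<inter> {p<..<q} = {}" "t \<in> {p..q}"
proof (cases "t = 1")
  case True
  define p where "p = Max (P \<inter> {..<1})"
  have "p \<in> P \<inter> {..<1}"
    unfolding p_def using assms by (intro Max_in) auto
  moreover have "s \<le> p" if "s \<in> P" "s < 1" for s
    unfolding p_def using assms that by (intro Max_ge) auto
  ultimately show ?thesis
    using assms True by (intro that[of p 1]) force+
next
  case False
  define p where "p = Max (P \<inter> {..t})"
  define q where "q = Min (P \<inter> {t<..})"
  have "p \<in> P \<inter> {..t}"
    unfolding p_def using assms by (intro Max_in) auto
  moreover have "q \<in> P \<inter> {t<..}"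
    unfolding q_def using assms False by (intro Min_in) auto
  moreover have "s \<le> p" if "s \<in> P" "s \<le> t" for s
    unfolding p_def using assms that by (intro Max_ge) auto
  moreover have "q \<le> s" if "s \<in> P" "t < s" for s
    unfolding q_def using assms that by (intro Min_le) auto
  ultimately show ?thesis
    by (intro that[of p q]) force+
qed

lemma dyadic_add:
  assumes "x \<in> dyadic" "y \<in> dyadic"
  shows "x + y \<in> dyadic"
proof -
  obtain m n m' n' where "x = real_of_int m / 2 ^ n" "y = real_of_int m' / 2 ^ n'"
    using assms by (auto simp: dyadic_def)
  then have "x + y = real_of_int (m * 2 ^ n' + m' * 2 ^ n) / 2 ^ (n + n')"
    by (simp add: add_divide_distrib power_add)
  then show ?thesis
    unfolding dyadic_def by blast
qed

lemma dyadic_uminus: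
  assumes "x \<in> dyadic"
  shows "- x \<in> dyadic"
proof -
  obtain m n where "x = real_of_int m / 2 ^ n"
    using assms by (auto simp: dyadic_def)
  then have "- x = real_of_int (- m) / 2 ^ n"
    by simp
  then show ?thesis
    unfolding dyadic_def by blast
qed

lemma dyadic_diff: "x \<in> dyadic \<Longrightarrow> y \<in> dyadic \<Longrightarrow> x - y \<in> dyadic"
  using dyadic_add[OF _ dyadic_uminus, of x y] by simp

lemma dyadic_powi_mult:
  assumes "x \<in> dyadic"
  shows "2 powi k * x \<in> dyadic"
proof -
  obtain m n where x: "x = real_of_int m / 2 ^ n"
    using assms by (auto simp: dyadic_def)
  show ?thesis
  proof (cases "0 \<le> k")
    case True
    then have "2 powi k * x = real_of_int (2 ^ nat k * m) / 2 ^ n"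
      by (simp add: x power_int_def)
    then show ?thesis
      unfolding dyadic_def by blast
  next
    case False
    then have "2 powi k * x = real_of_int m / 2 ^ (n + nat (- k))"
      by (simp add: x power_int_def power_add field_simps)
    then show ?thesis
      unfolding dyadic_def by blast
  qed
qed

lemma dyadic_piecewise_linear_value:
  assumes f: "dyadic_piecewise_linear f" and t: "t \<in> {0..1}"
  shows "f t \<in> dyadic \<longleftrightarrow> t \<in> dyadic"
proof -
  obtain P where P: "finite P" "{0, 1} \<subseteq> P" "P \<subseteq> {0..1} \<inter> dyadic" "f ` P \<subseteq> dyadic"
    and aff: "\<And>p q. p \<in> P \<Longrightarrow> q \<in> P \<Longrightarrow> p < q \<Longrightarrow> P \<inter> {p<..<q} = {} \<Longrightarrow>
      \<exists>(k :: int) d. \<forall>t\<in>{p..q}. f t = 2 powi k * t + d"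
    using f unfolding dyadic_piecewise_linear_def by metis
  obtain p q where pq: "p \<in> P" "q \<in> P" "p < q" "P \<inter> {p<..<q} = {}" "t \<in> {p..q}"
    using dyadic_cell[OF P(1,2) t] .
  then obtain k :: int and d where d: "\<And>t. t \<in> {p..q} \<Longrightarrow> f t = 2 powi k * t + d"
    using aff by blast
  have "d = f p - 2 powi k * p"
    using d[of p] pq by simp
  then have "d \<in> dyadic"
    using P(3,4) pq(1) by (simp add: image_subset_iff subset_iff dyadic_diff dyadic_powi_mult)
  have ft: "f t = 2 powi k * t + d"
    using d pq by blast
  then have t': "t = 2 powi (- k) * (f t - d)"
    by (simp add: power_int_minus)
  show ?thesis
  proof
    assume "f t \<in> dyadic"
    then show "t \<in> dyadic"
      using \<open>d \<in> dyadic\<close> by (subst t') (blast intro: dyadic_diff dyadic_powi_mult)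
  next
    assume "t \<in> dyadic"
    then show "f t \<in> dyadic"
      using \<open>d \<in> dyadic\<close> by (subst ft) (blast intro: dyadic_add dyadic_powi_mult)
  qed
qed

lemma dyadic_piecewise_linear_refine:
  assumes "finite P" "{0, 1} \<subseteq> P" "0 \<le> u" "u < v" "v \<le> 1" "P \<inter> {u<..<v :: real} = {}"
    and aff: "\<And>p q. p \<in> P \<Longrightarrow> q \<in> P \<Longrightarrow> p < q \<Longrightarrow> P \<inter> {p<..<q} = {} \<Longrightarrow>
      \<exists>(k :: int) d. \<forall>t\<in>{p..q}. f t = 2 powi k * t + d"
  shows "\<exists>(k :: int) d. \<forall>t\<in>{u..v}. f t = 2 powi k * t + (d :: real)"
proof -
  have "(u + v) / 2 \<in> {0..1}"
    using assms by auto
  then obtain p q where pq: "p \<in> P" "q \<in> P" "p < q" "P \<inter> {p<..<q} = {}" "(u + v) / 2 \<in> {p..q}"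
    using dyadic_cell[OF assms(1,2)] by metis
  have "p \<notin> {u<..<v}" "q \<notin> {u<..<v}"
    using pq assms(6) by auto
  then have "{u..v} \<subseteq> {p..q}"
    using pq(5) assms(4) by auto
  then show ?thesis
    using aff[OF pq(1-4)] by (meson subsetD)
qed

lemma homeomorphism_01_ends:
  fixes f :: "real \<Rightarrow> real"
  assumes "f ` {0..1} = {0..1 :: real}" "strict_mono_on {0..1} f"
  shows "f 0 = 0" "f 1 = 1"
proof -
  obtain s r where sr: "s \<in> {0..1}" "f s = 0" "r \<in> {0..1}" "f r = 1"
  proof -
    have "0 \<in> f ` {0..1}" "1 \<in> f ` {0..1}"
      unfolding assms(1) by simp_all
    then show ?thesis
      using that by (metis imageE)
  qed
  have "f 0 \<in> f ` {0..1}" "f 1 \<in> f ` {0..1}"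
    by simp_all
  then have "0 \<le> f 0" "f 1 \<le> 1"
    unfolding assms(1) by simp_all
  moreover have "f 0 \<le> f s" "f r \<le> f 1"
    using sr by (intro strict_mono_on_leD[OF assms(2)]; simp)+
  ultimately show "f 0 = 0" "f 1 = 1"
    using sr by simp_all
qed

lemma thompson_subgroup: "subgroup (carrier thompson_F) (BijGroup {0..1})"
proof -
  define I where "I = {0..1 :: real}"
  have memI: "f \<in> carrier thompson_F \<longleftrightarrow> f \<in> extensional I \<and> (\<exists>g. homeomorphism I I f g) \<and>
        strict_mono_on I f \<and> dyadic_piecewise_linear f" for f
    by (simp add: thompson_F_def I_def)
  have bij: "f \<in> Bij I" if "f \<in> carrier thompson_F" for f
    using that unfolding memI Bij_def
    by (simp add: bij_betw_def strict_mono_on_imp_inj_on) (metis homeomorphism_image1)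
  have img: "f ` I = I" and mono: "\<And>x y. x \<in> I \<Longrightarrow> y \<in> I \<Longrightarrow> f x < f y \<longleftrightarrow> x < y"
    and ends: "f 0 = 0" "f 1 = 1" if "f \<in> carrier thompson_F" for f
  proof -
    show "f ` I = I"
      using that homeomorphism_image1 unfolding memI by metis
    then show "f 0 = 0" "f 1 = 1"
      using that homeomorphism_01_ends[of f] unfolding memI I_def by auto
    show "f x < f y \<longleftrightarrow> x < y" if "x \<in> I" "y \<in> I" for x y
      using \<open>f \<in> carrier thompson_F\<close> that unfolding memI
      by (metis linorder_neqE order_less_asym strict_mono_onD order_less_irrefl)
  qed
  show ?thesis
    unfolding I_def[symmetric]
  proof (rule group.subgroupI[OF group_BijGroup])
    show "carrier thompson_F \<subseteq> carrier (BijGroup I)"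
      using bij by (auto simp: BijGroup_def)
    have "dyadic_piecewise_linear (\<lambda>t\<in>I. t)"
      unfolding dyadic_piecewise_linear_def
    proof (intro exI[of _ "{0, 1}"] conjI ballI impI)
      have "0 \<in> dyadic" "1 \<in> dyadic"
        unfolding dyadic_def mem_Collect_eq
        by (rule exI[of _ 0], simp) (rule exI[of _ 1], rule exI[of _ 0], simp)
      then show "{0, 1} \<subseteq> {0..1} \<inter> dyadic" "(\<lambda>t\<in>I. t) ` {0, 1} \<subseteq> dyadic"
        by (auto simp: I_def)
      fix p q :: real assume "p \<in> {0, 1}" "q \<in> {0, 1}"
      then show "\<exists>(k :: int) d. \<forall>t\<in>{p..q}. (\<lambda>t\<in>I. t) t = 2 powi k * t + d"
        by (intro exI[of _ 0]) (auto simp: I_def)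
    qed auto
    moreover have "homeomorphism I I (\<lambda>t\<in>I. t) (\<lambda>t. t)"
      by (rule homeomorphism_cong[OF homeomorphism_ident]) auto
    ultimately have "(\<lambda>t\<in>I. t) \<in> carrier thompson_F"
      unfolding memI by (auto simp: strict_mono_on_def)
    then show "carrier thompson_F \<noteq> {}"
      by blast
  next
    fix f assume f: "f \<in> carrier thompson_F"
    define h where "h = (\<lambda>x\<in>I. inv_into I f x)"
    have hf: "h (f x) = x" if "x \<in> I" for x
      using that bij[OF f] img[OF f] by (auto simp: h_def Bij_def bij_betw_def)
    have fh: "f (h x) = x" "h x \<in> I" if "x \<in> I" for x
      using that img[OF f] by (auto simp: h_def f_inv_into_f inv_into_into)
    obtain g where g: "homeomorphism I I f g"
      using f memI by blast
    have "homeomorphism I I h f"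
      by (rule homeomorphism_cong[OF homeomorphism_symD[OF g]])
        (use g fh hf in \<open>auto simp: homeomorphism_def, metis image_eqI\<close>)
    moreover have "strict_mono_on I h"
      using mono[OF f] fh by (intro strict_mono_onI) metis
    moreover have "dyadic_piecewise_linear h"
    proof -
      obtain P where P: "finite P" "{0, 1} \<subseteq> P" "P \<subseteq> {0..1} \<inter> dyadic" "f ` P \<subseteq> dyadic"
        and aff: "\<And>p q. p \<in> P \<Longrightarrow> q \<in> P \<Longrightarrow> p < q \<Longrightarrow> P \<inter> {p<..<q} = {} \<Longrightarrow>
          \<exists>(k :: int) d. \<forall>t\<in>{p..q}. f t = 2 powi k * t + d"
        using f unfolding memI dyadic_piecewise_linear_def by metis
      have PI: "P \<subseteq> I"
        using P(3) by (auto simp: I_def)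
      have "\<exists>(k :: int) d. \<forall>s\<in>{p'..q'}. h s = 2 powi k * s + d"
        if pq: "p' \<in> f ` P" "q' \<in> f ` P" "p' < q' \<and> f ` P \<inter> {p'<..<q'} = {}" for p' q'
      proof -
        obtain p q where pq': "p \<in> P" "q \<in> P" "p' = f p" "q' = f q"
          using pq by blast
        then have "p < q"
          using pq mono[OF f] PI by blast
        have "P \<inter> {p<..<q} = {}"
        proof (rule ccontr)
          assume "P \<inter> {p<..<q} \<noteq> {}"
          then obtain r where "r \<in> P" "p < r" "r < q"
            by auto
          then have "f r \<in> f ` P \<inter> {p'<..<q'}"
            using mono[OF f] PI pq' by auto
          then show False
            using pq by blast
        qed
        then obtain k :: int and d where d: "\<And>t. t \<in> {p..q} \<Longrightarrow> f t = 2 powi k * t + d"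
          using aff pq' \<open>p < q\<close> by blast
        have "h s = 2 powi (- k) * s + (- (2 powi (- k) * d))" if s: "s \<in> {p'..q'}" for s
        proof -
          have "p' \<in> I" "q' \<in> I"
            using pq' PI img[OF f] by blast+
          then have sI: "s \<in> I"
            using s by (auto simp: I_def)
          then have "h s \<in> {p..q}"
            using s fh[OF sI] mono[OF f] pq' PI by (metis atLeastAtMost_iff not_le subsetD)
          then have "s = 2 powi k * h s + d"
            using d fh[OF sI] by metis
          then show ?thesis
            by (simp add: power_int_minus field_simps)
        qed
        then show ?thesis
          by blast
      qed
      moreover have "h ` f ` P = P"
        using hf PI by (force simp: image_image)
      moreover have "f ` P \<subseteq> I"
        using PI img[OF f] by blast
      moreover have "{0, 1} \<subseteq> f ` P"
        using P(2) ends[OF f] by (metis empty_subsetI image_eqI insert_subset)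
      ultimately show ?thesis
        unfolding dyadic_piecewise_linear_def using P
        by (intro exI[of _ "f ` P"] conjI ballI impI) (auto simp: I_def)
    qed
    ultimately have "h \<in> carrier thompson_F"
      unfolding memI by (auto simp: h_def)
    then show "inv\<^bsub>BijGroup I\<^esub> f \<in> carrier thompson_F"
      using inv_BijGroup[OF bij[OF f]] by (simp add: h_def)
  next
    fix f g assume f: "f \<in> carrier thompson_F" and g: "g \<in> carrier thompson_F"
    obtain f' g' where hom: "homeomorphism I I f f'" "homeomorphism I I g g'"
      using f g memI by blast
    have "homeomorphism I I (compose I f g) (g' \<circ> f')"
      by (rule homeomorphism_cong[OF homeomorphism_compose[OF hom(2,1)]]) (auto simp: compose_def)
    moreover have gI: "g x \<in> I" if "x \<in> I" for x
      using img[OF g] that by blast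
    have "strict_mono_on I (compose I f g)"
      using mono[OF f] mono[OF g] gI by (intro strict_mono_onI) (simp add: compose_def)
    moreover have "dyadic_piecewise_linear (compose I f g)"
    proof -
      obtain P where P: "finite P" "{0, 1} \<subseteq> P" "P \<subseteq> {0..1} \<inter> dyadic" "f ` P \<subseteq> dyadic"
        and faff: "\<And>p q. p \<in> P \<Longrightarrow> q \<in> P \<Longrightarrow> p < q \<Longrightarrow> P \<inter> {p<..<q} = {} \<Longrightarrow>
          \<exists>(k :: int) d. \<forall>t\<in>{p..q}. f t = 2 powi k * t + d"
        using f unfolding memI dyadic_piecewise_linear_def by metis
      obtain Q where Q: "finite Q" "{0, 1} \<subseteq> Q" "Q \<subseteq> {0..1} \<inter> dyadic" "g ` Q \<subseteq> dyadic"
        and gaff: "\<And>p q. p \<in> Q \<Longrightarrow> q \<in> Q \<Longrightarrow> p < q \<Longrightarrow> Q \<inter> {p<..<q} = {} \<Longrightarrow>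
          \<exists>(k :: int) d. \<forall>t\<in>{p..q}. g t = 2 powi k * t + d"
        using g unfolding memI dyadic_piecewise_linear_def by metis
      define T where "T = Q \<union> {t \<in> I. g t \<in> P}"
      have TI: "T \<subseteq> I"
        using Q(3) by (auto simp: T_def I_def)
      have fin: "finite T"
      proof -
        have "inj_on g {t \<in> I. g t \<in> P}"
          using bij[OF g] by (auto simp: Bij_def bij_betw_def intro: inj_on_subset)
        moreover have "finite (g ` {t \<in> I. g t \<in> P})"
          using P(1) by (rule finite_subset[rotated]) auto
        ultimately show ?thesis
          using Q(1) by (auto simp: T_def dest: finite_imageD)
      qed
      have dyad: "dyadic_piecewise_linear f" "dyadic_piecewise_linear g"
        using f g memI by auto
      have Td: "T \<subseteq> dyadic"
        using P(3) Q(3) dyadic_piecewise_linear_value[OF dyad(2)] by (auto simp: T_def I_def)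
      have img_T: "compose I f g ` T \<subseteq> dyadic"
      proof
        fix y assume "y \<in> compose I f g ` T"
        then obtain t where "t \<in> T" "y = f (g t)"
          using TI by (auto simp: compose_def)
        then show "y \<in> dyadic"
          using Td TI gI[of t] dyadic_piecewise_linear_value[OF dyad(1), of "g t"]
            dyadic_piecewise_linear_value[OF dyad(2), of t] unfolding I_def by blast
      qed
      have "\<exists>(k :: int) d. \<forall>t\<in>{u..v}. compose I f g t = 2 powi k * t + d"
        if uv: "u \<in> T" "v \<in> T" "u < v \<and> T \<inter> {u<..<v} = {}" for u v
      proof -
        have uvI: "u \<in> I" "v \<in> I" "0 \<le> u" "v \<le> 1" "{u..v} \<subseteq> I"
          using uv TI by (auto simp: I_def)
        have "Q \<inter> {u<..<v} = {}"
          using uv by (auto simp: T_def)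
        then obtain k :: int and d where d: "\<And>t. t \<in> {u..v} \<Longrightarrow> g t = 2 powi k * t + d"
          using dyadic_piecewise_linear_refine[OF Q(1,2), of u v g] gaff uvI uv by blast
        have "P \<inter> {g u<..<g v} = {}"
        proof (rule ccontr)
          assume "P \<inter> {g u<..<g v} \<noteq> {}"
          then obtain s where s: "s \<in> P" "g u < s" "s < g v"
            by auto
          then have "s \<in> g ` I"
            using P(3) img[OF g] by (auto simp: I_def)
          then obtain t where "t \<in> I" "s = g t"
            by blast
          then show False
            using s uv mono[OF g] uvI by (auto simp: T_def)
        qed
        moreover have "0 \<le> g u" "g v \<le> 1" "g u < g v"
          using gI uvI uv mono[OF g] by (auto simp: I_def)
        ultimately obtain l :: int and e where e: "\<And>t. t \<in> {g u..g v} \<Longrightarrow> f t = 2 powi l * t + e"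
          using dyadic_piecewise_linear_refine[OF P(1,2), of "g u" "g v" f] faff by blast
        have "compose I f g t = 2 powi (l + k) * t + (2 powi l * d + e)" if t: "t \<in> {u..v}" for t
        proof -
          have "t \<in> I"
            using t uvI by blast
          moreover have "g t \<in> {g u..g v}"
            using t uvI mono[OF g] \<open>t \<in> I\<close> by (metis atLeastAtMost_iff not_le)
          ultimately show ?thesis
            using e[of "g t"] d[OF t] by (simp add: compose_def power_int_add algebra_simps)
        qed
        then show ?thesis
          by blast
      qed
      moreover have "{0, 1} \<subseteq> T" "T \<subseteq> {0..1} \<inter> dyadic"
        using Q(2) Td TI by (auto simp: T_def I_def)
      ultimately show ?thesis
        unfolding dyadic_piecewise_linear_def using fin img_T by (intro exI[of _ T]) blast
    qed
    ultimately have "compose I f g \<in> carrier thompson_F"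
      unfolding memI by auto
    then show "f \<otimes>\<^bsub>BijGroup I\<^esub> g \<in> carrier thompson_F"
      using bij[OF f] bij[OF g] by (simp add: BijGroup_def)
  qed
qed

lemma group_thompson_F: "group thompson_F"
proof -
  have "thompson_F = BijGroup {0..1} \<lparr>carrier := carrier thompson_F\<rparr>"
    by (simp add: thompson_F_def)
  then show ?thesis
    using subgroup.subgroup_is_group[OF thompson_subgroup group_BijGroup] by simp
qed


lemma thompson_memI:
  assumes ext: "f \<in> extensional {0..1}" and cont: "continuous_on {0..1} f"
    and mono: "strict_mono_on {0..1} f" and ends: "f 0 = 0" "f 1 = 1"
    and pl: "dyadic_piecewise_linear f"
  shows "f \<in> carrier thompson_F"
proof -
  have "f ` {0..1} = {0..1}"
  proof
    show "f ` {0..1} \<subseteq> {0..1}"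
    proof
      fix y assume "y \<in> f ` {0..1}"
      then obtain x where x: "x \<in> {0..1}" "y = f x"
        by blast
      then have "f 0 \<le> f x" "f x \<le> f 1"
        by (intro strict_mono_on_leD[OF mono]; simp)+
      then show "y \<in> {0..1}"
        using ends x by simp
    qed
    show "{0..1} \<subseteq> f ` {0..1}"
    proof
      fix y :: real assume "y \<in> {0..1}"
      then obtain x where "0 \<le> x" "x \<le> 1" "f x = y"
        using IVT'[of f 0 y 1] ends cont by auto
      then show "y \<in> f ` {0..1}"
        by (intro image_eqI[of _ _ x]) auto
    qed
  qed
  then obtain g where "homeomorphism {0..1} {0..1} f g"
    using homeomorphism_compact[OF compact_Icc cont] strict_mono_on_imp_inj_on[OF mono] by metis
  then show ?thesis
    using assms by (auto simp: thompson_F_def)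
qed

lemma dyadic_numerals: "0 \<in> dyadic" "1 \<in> dyadic" "1/2 \<in> dyadic" "3/4 \<in> dyadic" "7/8 \<in> dyadic"
  "1/4 \<in> dyadic"
proof -
  have *: "real_of_int m / 2 ^ n \<in> dyadic" for m n
    by (auto simp: dyadic_def)
  show "0 \<in> dyadic" "1 \<in> dyadic" "1/2 \<in> dyadic" "3/4 \<in> dyadic" "7/8 \<in> dyadic" "1/4 \<in> dyadic"
    using *[of 0 0] *[of 1 0] *[of 1 1] *[of 3 2] *[of 7 3] *[of 1 2] by simp_all
qed

lemma thompson_x0_mem: "thompson_x0 \<in> carrier thompson_F"
proof (rule thompson_memI)
  have max: "thompson_x0 t = max (t / 2) (max (t - 1/4) (2 * t - 1))" if "t \<in> {0..1}" for t
    using that by (auto simp: thompson_x0_def)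
  have "continuous_on {0..1} (\<lambda>t :: real. max (t / 2) (max (t - 1/4) (2 * t - 1)))"
    by (intro continuous_intros) auto
  then show "continuous_on {0..1} thompson_x0"
    using max by (metis (no_types, lifting) continuous_on_cong)
  show "strict_mono_on {0..1} thompson_x0"
    by (intro strict_mono_onI) (simp add: thompson_x0_def)
  show "dyadic_piecewise_linear thompson_x0"
    unfolding dyadic_piecewise_linear_def
  proof (intro exI[of _ "{0, 1/2, 3/4, 1}"] conjI ballI impI)
    show "{0, 1/2, 3/4, 1} \<subseteq> {0..1} \<inter> dyadic" "thompson_x0 ` {0, 1/2, 3/4, 1} \<subseteq> dyadic"
      using dyadic_numerals by (auto simp: thompson_x0_def)
    fix p q :: real
    assume "p \<in> {0, 1/2, 3/4, 1}" "q \<in> {0, 1/2, 3/4, 1}"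
      and "p < q \<and> {0, 1/2, 3/4, 1} \<inter> {p<..<q} = {}"
    then consider "p = 0" "q = 1/2" | "p = 1/2" "q = 3/4" | "p = 3/4" "q = 1"
      by (elim insertE emptyE; hypsubst; simp)
    then show "\<exists>(k :: int) d. \<forall>t\<in>{p..q}. thompson_x0 t = 2 powi k * t + d"
    proof cases
      case 1
      then show ?thesis
        by (intro exI[of _ "-1"] exI[of _ 0]) (auto simp: thompson_x0_def power_int_minus)
    next
      case 2
      then show ?thesis
        by (intro exI[of _ 0] exI[of _ "-1/4"]) (auto simp: thompson_x0_def)
    next
      case 3
      then show ?thesis
        by (intro exI[of _ 1] exI[of _ "-1"]) (auto simp: thompson_x0_def)
    qed
  qed auto
qed (auto simp: thompson_x0_def)

lemma thompson_x1_mem: "thompson_x1 \<in> carrier thompson_F"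
proof (rule thompson_memI)
  have x1: "thompson_x1 t = (if t \<le> 1/2 then t else if t \<le> 3/4 then t / 2 + 1/4
      else if t \<le> 7/8 then t - 1/8 else 2 * t - 1)" if "t \<in> {0..1}" for t
    using that by (auto simp: thompson_x1_def thompson_x0_def field_simps)
  have max: "thompson_x1 t = min t (max (t / 2 + 1/4) (max (t - 1/8) (2 * t - 1)))"
    if "t \<in> {0..1}" for t
    using that by (auto simp: x1)
  have "continuous_on {0..1} (\<lambda>t :: real. min t (max (t / 2 + 1/4) (max (t - 1/8) (2 * t - 1))))"
    by (intro continuous_intros) auto
  then show "continuous_on {0..1} thompson_x1"
    using max by (metis (no_types, lifting) continuous_on_cong)
  show "strict_mono_on {0..1} thompson_x1"
    by (intro strict_mono_onI) (simp add: x1)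
  show "dyadic_piecewise_linear thompson_x1"
    unfolding dyadic_piecewise_linear_def
  proof (intro exI[of _ "{0, 1/2, 3/4, 7/8, 1}"] conjI ballI impI)
    have "5/8 = 1/2 + 2 powi (-1) * (1/4 :: real)"
      by (simp add: power_int_minus)
    then have "5/8 \<in> dyadic"
      using dyadic_add[OF dyadic_numerals(3) dyadic_powi_mult[OF dyadic_numerals(6), of "-1"]] by simp
    then show "{0, 1/2, 3/4, 7/8, 1} \<subseteq> {0..1} \<inter> dyadic"
      "thompson_x1 ` {0, 1/2, 3/4, 7/8, 1} \<subseteq> dyadic"
      using dyadic_numerals by (auto simp: x1)
    fix p q :: real
    assume "p \<in> {0, 1/2, 3/4, 7/8, 1}" "q \<in> {0, 1/2, 3/4, 7/8, 1}"
      and "p < q \<and> {0, 1/2, 3/4, 7/8, 1} \<inter> {p<..<q} = {}"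
    then consider "p = 0" "q = 1/2" | "p = 1/2" "q = 3/4" | "p = 3/4" "q = 7/8" | "p = 7/8" "q = 1"
      by (elim insertE emptyE; hypsubst; simp)
    then show "\<exists>(k :: int) d. \<forall>t\<in>{p..q}. thompson_x1 t = 2 powi k * t + d"
    proof cases
      case 1
      then show ?thesis
        by (intro exI[of _ 0] exI[of _ 0]) (auto simp: x1)
    next
      case 2
      then show ?thesis
        by (intro exI[of _ "-1"] exI[of _ "1/4"]) (auto simp: x1 power_int_minus)
    next
      case 3
      then show ?thesis
        by (intro exI[of _ 0] exI[of _ "-1/8"]) (auto simp: x1)
    next
      case 4
      then show ?thesis
        by (intro exI[of _ 1] exI[of _ "-1"]) (auto simp: x1)
    qed
  qed auto
qed (auto simp: thompson_x1_def thompson_x0_def)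


section \<open>Generators and relators\<close>

abbreviation wa :: word where "wa \<equiv> [(0, True)]"
abbreviation wb :: word where "wb \<equiv> [(1, True)]"
abbreviation wc :: word where "wc \<equiv> [(2, True)]"

text \<open>With \<open>x = a\<close> and \<open>y = b\<close> these are \<open>R\<^sub>1\<close>, \<open>R\<^sub>2\<close>; with \<open>y = c\<close> they are \<open>R\<^sub>3\<close>, \<open>R\<^sub>4\<close>.\<close>

definition thompson_relators :: "word \<Rightarrow> word \<Rightarrow> word set" where
  "thompson_relators x y =
     {wcomm (y @ wpow x (-1)) (wpow x (-1) @ y @ x),
      wcomm (y @ wpow x (-1)) (wpow x (-2) @ y @ wpow x 2)}"

end

theory Submission
  imports Defs
begin

text \<open>Let \<open>y\<close> be \<open>x\<^sub>1\<close> or any of the \<open>w\<^sub>n\<close> with \<open>t\<^sub>n \<ge> 1/2\<close>.  Then \<open>x\<^sub>0, y\<close> satisfy Thompson's two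
  relators, and conversely every relation between \<open>x\<^sub>0\<close> and \<open>y\<close> is a consequence of them: modulo the
  relators each word is a fraction of positive words in \<open>X\<^sub>0 = a\<close>, \<open>X\<^sub>n\<^sub>+\<^sub>1 = a\<^bsup>-n\<^esup> b a\<^bsup>n\<^esup>\<close>, and the
  action on the points \<open>1 - (1 - \<tau>) / 2\<^bsup>k\<^esup>\<close> detects the least index occurring in a positive word, which
  can then be moved to the front and cancelled.

  Hence a word \<open>v(a, b, c)\<close> is trivial in \<open>G\<^sub>n\<close> iff \<open>v(x\<^sub>0, x\<^sub>1, w\<^sub>n) = 1\<close>.  For each relator of \<open>G\<close> this
  holds for large \<open>n\<close>, because elements with complementary supports commute.  Conversely, in \<open>G\<close> we have
  \<open>v(a, b, c) = v(a, b, 1) v(a, a, 1)\<^sup>-\<^sup>1 v(a, a, c)\<close>.  If \<open>v\<close> is trivial in \<open>G\<^sub>n\<close> for infinitely many \<open>n\<close>,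
  then \<open>v(x\<^sub>0, x\<^sub>1, 1) = 1\<close> since the support of \<open>w\<^sub>n\<close> shrinks to 1, so the first two factors are
  trivial; the identity \<open>v(a, b, c) = v(a, a, c)\<close> then passes from \<open>G\<close> to \<open>G\<^sub>n\<close>, whence
  \<open>v(x\<^sub>0, x\<^sub>0, w\<^sub>n) = 1\<close> and the third factor is trivial as well.\<close>

section \<open>Groups with two elements satisfying Thompson's relators\<close>

context group
begin

lemma inv_mult_cancel:
  assumes "x \<in> carrier G" "y \<in> carrier G"
  shows "inv x \<otimes> (x \<otimes> y) = y" "x \<otimes> (inv x \<otimes> y) = y"
  using assms by (simp_all add: m_assoc[symmetric])

lemma commute_mult:
  assumes "z \<otimes> x = x \<otimes> z" "z \<otimes> y = y \<otimes> z" "x \<in> carrier G" "y \<in> carrier G" "z \<in> carrier G"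
  shows "z \<otimes> (x \<otimes> y) = (x \<otimes> y) \<otimes> z"
proof -
  have "z \<otimes> (x \<otimes> y) = (z \<otimes> x) \<otimes> y"
    using assms(3-5) by (simp add: m_assoc)
  also have "\<dots> = x \<otimes> (z \<otimes> y)"
    unfolding assms(1) using assms(3-5) by (simp add: m_assoc)
  also have "\<dots> = (x \<otimes> y) \<otimes> z"
    unfolding assms(2) using assms(3-5) by (simp add: m_assoc)
  finally show ?thesis .
qed

lemma commute_inv:
  assumes "z \<otimes> x = x \<otimes> z" "x \<in> carrier G" "z \<in> carrier G"
  shows "z \<otimes> inv x = inv x \<otimes> z"
proof -
  have "inv x \<otimes> (z \<otimes> x) \<otimes> inv x = inv x \<otimes> (x \<otimes> z) \<otimes> inv x"
    by (simp only: assms(1))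
  then show ?thesis
    using assms(2,3) by (simp add: m_assoc inv_mult_cancel)
qed

lemma inv_mult_swap:
  assumes "x \<otimes> y = z \<otimes> x'" "x \<in> carrier G" "y \<in> carrier G" "z \<in> carrier G" "x' \<in> carrier G"
  shows "inv z \<otimes> x = x' \<otimes> inv y"
proof -
  have "inv z \<otimes> (x \<otimes> y) \<otimes> inv y = inv z \<otimes> (z \<otimes> x') \<otimes> inv y"
    using assms by simp
  then show ?thesis
    using assms(2-) by (simp add: m_assoc inv_mult_cancel)
qed

lemma commutator_eq_one_iff:
  assumes "x \<in> carrier G" "y \<in> carrier G"
  shows "x \<otimes> (y \<otimes> (inv x \<otimes> inv y)) = \<one> \<longleftrightarrow> x \<otimes> y = y \<otimes> x"
proof -
  have "x \<otimes> (y \<otimes> (inv x \<otimes> inv y)) = (x \<otimes> y) \<otimes> inv (y \<otimes> x)"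
    using assms by (simp add: m_assoc inv_mult_group)
  then show ?thesis
    using assms by (simp add: inv_solve_right')
qed

end

section \<open>The infinite presentation derived from the two relators\<close>

locale thompson_pair = group +
  fixes a b
  assumes a_closed [simp, intro]: "a \<in> carrier G" and b_closed [simp, intro]: "b \<in> carrier G"
    and rel1: "(b \<otimes> inv a) \<otimes> (inv a \<otimes> b \<otimes> a) = (inv a \<otimes> b \<otimes> a) \<otimes> (b \<otimes> inv a)"
    and rel2: "(b \<otimes> inv a) \<otimes> (inv a \<otimes> (inv a \<otimes> b \<otimes> a) \<otimes> a) =
               (inv a \<otimes> (inv a \<otimes> b \<otimes> a) \<otimes> a) \<otimes> (b \<otimes> inv a)"
begin

text \<open>These are the generators of the infinite presentation of F, whose relations
  \<open>X_mult\<close> say that conjugation by \<open>X k\<close> raises every larger index by one.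
  The case \<open>n = 0\<close> is separate because conjugating \<open>X 0 = a\<close> by
  \<open>a\<close> gives \<open>a\<close> again. In this notation \<open>rel1\<close> and
  \<open>rel2\<close> say that \<open>b \<otimes> inv a\<close> commutes with \<open>X 2\<close> and
  with \<open>X 3\<close>.\<close>

primrec X :: "nat \<Rightarrow> 'a" where
  "X 0 = a"
| "X (Suc n) = (if n = 0 then b else inv a \<otimes> X n \<otimes> a)"

lemma X_closed [simp, intro]: "X n \<in> carrier G"
  by (induction n) auto

lemma X_mult_a: "X (Suc n) \<otimes> a = a \<otimes> X (Suc (Suc n))"
  by (simp add: m_assoc inv_mult_cancel)

text \<open>Conjugation by \<open>a\<close> shifts every positive index up by one, so it carries a
  relation between such generators to the shifted one.\<close>

lemma conj_a:
  assumes "X (Suc n) \<otimes> X (Suc k) = X (Suc k) \<otimes> X (Suc (Suc n))"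
  shows "X (Suc (Suc n)) \<otimes> X (Suc (Suc k)) = X (Suc (Suc k)) \<otimes> X (Suc (Suc (Suc n)))"
proof -
  have conj: "(inv a \<otimes> x \<otimes> a) \<otimes> (inv a \<otimes> y \<otimes> a) = inv a \<otimes> (x \<otimes> y) \<otimes> a"
    if "x \<in> carrier G" "y \<in> carrier G" for x y
    using that by (simp add: m_assoc inv_mult_cancel)
  have step: "X (Suc (Suc m)) \<otimes> X (Suc (Suc l)) = inv a \<otimes> (X (Suc m) \<otimes> X (Suc l)) \<otimes> a" for m l
    using conj[of "X (Suc m)" "X (Suc l)"] by simp
  show ?thesis
    by (simp only: step assms)
qed

text \<open>Multiply on the right by \<open>a\<close> and move it past the generator. The gain is
  that commuting with \<open>b \<otimes> inv a\<close> is preserved by products and inverses, unlike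
  the relation on the right.\<close>

lemma X_mult_b_iff:
  "(b \<otimes> inv a) \<otimes> X (Suc n) = X (Suc n) \<otimes> (b \<otimes> inv a) \<longleftrightarrow>
     X (Suc n) \<otimes> b = b \<otimes> X (Suc (Suc n))"
proof -
  have "(b \<otimes> inv a) \<otimes> X (Suc n) = X (Suc n) \<otimes> (b \<otimes> inv a) \<longleftrightarrow>
      (b \<otimes> inv a) \<otimes> X (Suc n) \<otimes> a = X (Suc n) \<otimes> (b \<otimes> inv a) \<otimes> a"
    by (metis X_closed a_closed b_closed inv_closed m_closed right_cancel)
  also have "(b \<otimes> inv a) \<otimes> X (Suc n) \<otimes> a = b \<otimes> X (Suc (Suc n))"
    by (simp add: m_assoc)
  also have "X (Suc n) \<otimes> (b \<otimes> inv a) \<otimes> a = X (Suc n) \<otimes> b"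
    by (simp add: m_assoc del: X.simps)
  finally show ?thesis
    by metis
qed

text \<open>Two relators suffice for the whole sequence because the induction carries two
  consecutive commutations; \<open>rel1\<close> and \<open>rel2\<close> start it at the indices 2
  and 3.\<close>

lemma X_mult_b: "X (Suc (Suc n)) \<otimes> b = b \<otimes> X (Suc (Suc (Suc n)))"
proof -
  define d where "d = b \<otimes> inv a"
  have d: "d \<in> carrier G"
    by (simp add: d_def)
  have "d \<otimes> X (Suc (Suc n)) = X (Suc (Suc n)) \<otimes> d \<and>
      d \<otimes> X (Suc (Suc (Suc n))) = X (Suc (Suc (Suc n))) \<otimes> d"
  proof (induction n)
    case 0
    then show ?case
      using rel1 rel2 by (simp add: d_def)
  next
    case (Suc n)
    have "X (Suc (Suc n)) \<otimes> X (Suc 0) = X (Suc 0) \<otimes> X (Suc (Suc (Suc n)))"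
      using Suc X_mult_b_iff[of "Suc n"] by (simp add: d_def del: X.simps(2)) simp
    \<comment> \<open>The commutation at index \<open>n + 2\<close> gives a relation with
      \<open>b\<close>; its shift expresses \<open>X (n + 4)\<close> through \<open>X 2\<close> and
      \<open>X (n + 3)\<close>, both of which commute with \<open>d\<close>.\<close>
    from conj_a[OF this] have "X (Suc (Suc (Suc (Suc n)))) =
        inv (X (Suc (Suc 0))) \<otimes> (X (Suc (Suc (Suc n))) \<otimes> X (Suc (Suc 0)))"
      by (metis X_closed inv_mult_cancel(1))
    moreover have "d \<otimes> X (Suc (Suc 0)) = X (Suc (Suc 0)) \<otimes> d"
      using rel1 by (simp add: d_def)
    ultimately have "d \<otimes> X (Suc (Suc (Suc (Suc n)))) = X (Suc (Suc (Suc (Suc n)))) \<otimes> d"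
      using Suc d by (simp only:) (intro commute_mult commute_inv; simp del: X.simps)
    then show ?case
      using Suc by blast
  qed
  then show ?thesis
    using X_mult_b_iff[of "Suc n"] unfolding d_def by blast
qed

lemma X_mult: "k < n \<Longrightarrow> X n \<otimes> X k = X k \<otimes> X (Suc n)"
proof (induction k arbitrary: n)
  case 0
  then obtain m where "n = Suc m"
    using not0_implies_Suc by blast
  then show ?case
    using X_mult_a by simp
next
  case (Suc k)
  then obtain m where m: "n = Suc m" "k < m"
    by (metis Suc_lessE)
  then obtain l where l: "m = Suc l"
    by (cases m) auto
  have IH: "X m \<otimes> X k = X k \<otimes> X (Suc m)"
    using Suc.IH[OF m(2)] .
  show ?case
  proof (cases k)
    case 0
    have b: "X (Suc 0) = b"
      by simp
    show ?thesis
      unfolding m(1) l 0 b by (rule X_mult_b)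
  next
    case (Suc j)
    show ?thesis
      using conj_a[OF IH[unfolded l Suc]] unfolding m(1) l Suc .
  qed
qed

section \<open>Positive words and fractions\<close>

definition pos :: "nat list \<Rightarrow> 'a" where
  "pos L = foldr (\<lambda>n g. X n \<otimes> g) L \<one>"

lemma pos_simps [simp]: "pos [] = \<one>" "pos (n # L) = X n \<otimes> pos L"
  by (simp_all add: pos_def)

lemma pos_closed [simp, intro]: "pos L \<in> carrier G"
  by (induction L) auto

lemma pos_append: "pos (L @ M) = pos L \<otimes> pos M"
  by (induction L) (auto simp: m_assoc)

text \<open>The inverse letter is pushed to the right through \<open>L\<close>. Passing a larger
  index raises that index, passing a smaller one raises \<open>k\<close>, and meeting its own index
  cancels it. If it reaches the end, the letter in \<open>r\<close> cancels it.\<close>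

lemma inv_X_mult_pos: "\<exists>r p. inv (X k) \<otimes> pos L \<otimes> pos r = pos p"
proof (induction L arbitrary: k)
  case Nil
  have "inv (X k) \<otimes> pos [] \<otimes> pos [k] = pos []"
    by simp
  then show ?case
    by blast
next
  case (Cons j L)
  consider "j = k" | "k < j" | "j < k"
    by linarith
  then show ?case
  proof cases
    case 1
    have "inv (X k) \<otimes> pos (j # L) \<otimes> pos [] = pos L"
      using 1 by (simp add: inv_mult_cancel)
    then show ?thesis
      by blast
  next
    case 2
    obtain r p where rp: "inv (X k) \<otimes> pos L \<otimes> pos r = pos p"
      using Cons by blast
    have "inv (X k) \<otimes> X j = X (Suc j) \<otimes> inv (X k)"
      using X_mult[OF 2] by (intro inv_mult_swap) auto
    then have "inv (X k) \<otimes> pos (j # L) \<otimes> pos r = X (Suc j) \<otimes> (inv (X k) \<otimes> pos L \<otimes> pos r)"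
      by (simp add: m_assoc[symmetric] del: X.simps)
    then show ?thesis
      using rp by (metis pos_simps(2))
  next
    case 3
    obtain r p where rp: "inv (X (Suc k)) \<otimes> pos L \<otimes> pos r = pos p"
      using Cons by blast
    have "inv (X k) \<otimes> X j = X j \<otimes> inv (X (Suc k))"
      using X_mult[OF 3, symmetric] by (intro inv_mult_swap) auto
    then have "inv (X k) \<otimes> pos (j # L) \<otimes> pos r = X j \<otimes> (inv (X (Suc k)) \<otimes> pos L \<otimes> pos r)"
      by (simp add: m_assoc[symmetric] del: X.simps)
    then show ?thesis
      using rp by (metis pos_simps(2))
  qed
qed

text \<open>Every element of the subgroup is a fraction \<open>pos p\<close> over
  \<open>pos q\<close>, written without inverses. A new inverse letter is absorbed by lengthening
  the denominator.\<close>

lemma word_eval_fraction: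
  assumes "v \<in> words 2"
  shows "\<exists>p q. word_eval G [a, b] v \<otimes> pos q = pos p"
  using assms
proof (induction v)
  case Nil
  have "word_eval G [a, b] [] \<otimes> pos [] = pos []"
    by simp
  then show ?case
    by blast
next
  case (Cons x v)
  obtain i e where x: "x = (i, e)"
    by (cases x)
  then have i: "i < 2" "[a, b] ! i = X i"
    using Cons.prems by (auto simp: less_2_cases_iff)
  have v: "word_eval G [a, b] v \<in> carrier G"
    using word_eval_closed[of "[a, b]" 2 v] Cons.prems by simp
  obtain p q where pq: "word_eval G [a, b] v \<otimes> pos q = pos p"
    using Cons by auto
  show ?case
  proof (cases e)
    case True
    then have "word_eval G [a, b] (x # v) \<otimes> pos q = pos (i # p)"
      using x i v pq by (simp add: m_assoc del: X.simps)
    then show ?thesis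
      by blast
  next
    case False
    obtain r p' where "inv (X i) \<otimes> pos p \<otimes> pos r = pos p'"
      using inv_X_mult_pos by blast
    then have "word_eval G [a, b] (x # v) \<otimes> pos (q @ r) = pos p'"
      using x i v pq[symmetric] False by (simp add: m_assoc pos_append del: X.simps)
    then show ?thesis
      by blast
  qed
qed

text \<open>The first occurrence of \<open>X k\<close> moves left past larger letters, each of which
  only has its index raised. The length equation feeds the induction in
  \<open>pos_inj\<close>.\<close>

lemma extract_min:
  assumes "k \<in> set L" "\<forall>n\<in>set L. k \<le> n"
  shows "\<exists>L'. length L = Suc (length L') \<and> pos L = X k \<otimes> pos L'"
  using assms
proof (induction L)
  case (Cons n L)
  show ?case
  proof (cases "n = k")
    case True
    then show ?thesis
      by auto
  next
    case False
    then obtain L' where L': "length L = Suc (length L')" "pos L = X k \<otimes> pos L'"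
      using Cons by auto
    have "X n \<otimes> X k = X k \<otimes> X (Suc n)"
      using Cons.prems False by (intro X_mult) auto
    then have "pos (n # L) = X k \<otimes> pos (Suc n # L')"
      using L' by (simp add: m_assoc[symmetric] del: X.simps)
    then show ?thesis
      using L' by (intro exI[of _ "Suc n # L'"]) simp
  qed
qed simp

end

section \<open>Thompson's group as a group of maps\<close>

interpretation TF: group thompson_F
  by (rule group_thompson_F)

lemma thompson_Bij: "f \<in> carrier thompson_F \<Longrightarrow> f \<in> Bij {0..1}"
proof -
  assume "f \<in> carrier thompson_F"
  then have "f \<in> carrier (BijGroup {0..1})"
    using subgroup.subset[OF thompson_subgroup] by blast
  then show ?thesis
    by (simp add: BijGroup_def)
qed

lemma thompson_mult_apply:
  assumes "f \<in> carrier thompson_F" "g \<in> carrier thompson_F" "s \<in> {0..1}"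
  shows "(f \<otimes>\<^bsub>thompson_F\<^esub> g) s = f (g s)"
  using thompson_Bij[OF assms(1)] thompson_Bij[OF assms(2)] assms(3)
  by (simp add: thompson_F_def BijGroup_def compose_def)

lemma thompson_one_apply: "s \<in> {0..1} \<Longrightarrow> \<one>\<^bsub>thompson_F\<^esub> s = s"
  by (simp add: thompson_F_def BijGroup_def)

lemma thompson_range:
  assumes "f \<in> carrier thompson_F" "s \<in> {0..1}"
  shows "f s \<in> {0..1}"
  using Bij_imp_funcset[OF thompson_Bij[OF assms(1)]] assms(2) by blast

lemma thompson_inv_apply:
  assumes "f \<in> carrier thompson_F" "s \<in> {0..1}"
  shows "f ((inv\<^bsub>thompson_F\<^esub> f) s) = s" "(inv\<^bsub>thompson_F\<^esub> f) (f s) = s"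
  using assms thompson_mult_apply[of f "inv\<^bsub>thompson_F\<^esub> f" s]
    thompson_mult_apply[of "inv\<^bsub>thompson_F\<^esub> f" f s] by (simp_all add: thompson_one_apply)

lemma thompson_less_iff:
  assumes "f \<in> carrier thompson_F" "s \<in> {0..1}" "r \<in> {0..1}"
  shows "f s < f r \<longleftrightarrow> s < r"
proof -
  have "strict_mono_on {0..1} f"
    using assms(1) by (simp add: thompson_F_def)
  then show ?thesis
    using assms(2,3) by (metis linorder_neqE order_less_asym strict_mono_onD order_less_irrefl)
qed

lemma thompson_le_iff:
  assumes "f \<in> carrier thompson_F" "s \<in> {0..1}" "r \<in> {0..1}"
  shows "f s \<le> f r \<longleftrightarrow> s \<le> r"
  using thompson_less_iff[OF assms(1,3,2)] by (simp add: not_less[symmetric])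

lemma thompson_ends:
  assumes "f \<in> carrier thompson_F"
  shows "f 0 = 0" "f 1 = 1"
proof -
  have "f ` {0..1} = {0..1}"
    using thompson_Bij[OF assms] by (simp add: Bij_def bij_betw_def)
  moreover have "strict_mono_on {0..1} f"
    using assms by (simp add: thompson_F_def)
  ultimately show "f 0 = 0" "f 1 = 1"
    using homeomorphism_01_ends by blast+
qed

text \<open>All elements fix 1, so 1 may be left out of the test. The limit argument relies on this:
  only points below 1 are eventually below \<open>t n\<close>.\<close>

lemma thompson_eqI:
  assumes "f \<in> carrier thompson_F" "g \<in> carrier thompson_F" "\<And>s. s \<in> {0..<1} \<Longrightarrow> f s = g s"
  shows "f = g"
proof (rule extensionalityI)
  show "f \<in> extensional {0..1}" "g \<in> extensional {0..1}"
    using assms(1,2) by (simp_all add: thompson_F_def)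
  show "f s = g s" if "s \<in> {0..1}" for s
    using assms(3)[of s] that thompson_ends[OF assms(1)] thompson_ends[OF assms(2)]
    by (cases "s = 1") auto
qed

text \<open>By monotonicity \<open>f\<close> preserves \<open>{0..z}\<close> and \<open>g\<close>
  preserves \<open>{z..1}\<close>, so at each point one of the two maps acts trivially before and
  after the other.\<close>

lemma thompson_commute:
  assumes f: "f \<in> carrier thompson_F" and g: "g \<in> carrier thompson_F" and z: "z \<in> {0..1}"
    and fz: "\<And>s. s \<in> {z..1} \<Longrightarrow> f s = s" and gz: "\<And>s. s \<in> {0..z} \<Longrightarrow> g s = s"
  shows "f \<otimes>\<^bsub>thompson_F\<^esub> g = g \<otimes>\<^bsub>thompson_F\<^esub> f"
proof (rule thompson_eqI)
  fix s :: real assume "s \<in> {0..<1}"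
  then have s: "s \<in> {0..1}"
    by simp
  have "f (g s) = g (f s)"
  proof (cases "s \<le> z")
    case True
    then have "f s \<le> f z"
      using thompson_le_iff[OF f s z] by simp
    then have "f s \<in> {0..z}"
      using fz[of z] z thompson_range[OF f s] by simp
    then show ?thesis
      using gz s True by simp
  next
    case False
    then have "g z \<le> g s"
      using thompson_le_iff[OF g z s] by simp
    then have "g s \<in> {z..1}"
      using gz[of z] z thompson_range[OF g s] by simp
    then show ?thesis
      using fz s False by simp
  qed
  then show "(f \<otimes>\<^bsub>thompson_F\<^esub> g) s = (g \<otimes>\<^bsub>thompson_F\<^esub> f) s"
    using f g s by (simp add: thompson_mult_apply)
qed (use f g in auto)

section \<open>The generator x_0 and elements that behave like x_1 near 1\<close>

declare thompson_x0_mem [simp, intro] thompson_x1_mem [simp, intro]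

lemma thompson_x0_apply:
  assumes "s \<in> {0..1}"
  shows "thompson_x0 s \<le> s" "0 < s \<Longrightarrow> s < 1 \<Longrightarrow> thompson_x0 s < s"
    "3/4 \<le> s \<Longrightarrow> thompson_x0 s = 2 * s - 1"
  using assms by (auto simp: thompson_x0_def)

lemma inv_thompson_x0_apply:
  assumes "s \<in> {1/2..1}"
  shows "(inv\<^bsub>thompson_F\<^esub> thompson_x0) s = (1 + s) / 2"
proof -
  have "thompson_x0 ((1 + s) / 2) = s"
    using assms by (subst thompson_x0_apply(3)) (auto simp: field_simps)
  then show ?thesis
    using thompson_inv_apply(2)[OF thompson_x0_mem, of "(1 + s) / 2"] assms by simp
qed

text \<open>The hypothesis of the theorem on \<open>w\<^sub>n\<close>, with \<open>\<tau> = t\<^sub>n\<close>.\<close>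

definition x1_like :: "real \<Rightarrow> (real \<Rightarrow> real) \<Rightarrow> bool" where
  "x1_like \<tau> y \<longleftrightarrow> y \<in> carrier thompson_F \<and> \<tau> \<in> {1/2..<1} \<and>
     (\<forall>s\<in>{0..\<tau>}. y s = s) \<and> (\<forall>s\<in>{(3 + \<tau>) / 4..1}. y s = 2 * s - 1)"

text \<open>This lets x_1 and the w_n be treated by the same arguments.\<close>

lemma x1_like_x1: "x1_like (1/2) thompson_x1"
  using thompson_x1_mem unfolding x1_like_def
  by (auto simp: thompson_x1_def thompson_x0_def field_simps)

text \<open>On this interval the inverse of x_0 is the map from \<open>s\<close> to
  \<open>(1 + s) / 2\<close>, with values in the interval where \<open>y\<close> is linear and
  undoes it.\<close>

lemma x1_like_mult_inv_x0:
  assumes "x1_like \<tau> y" "s \<in> {(1 + \<tau>) / 2..1}"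
  shows "(y \<otimes>\<^bsub>thompson_F\<^esub> inv\<^bsub>thompson_F\<^esub> thompson_x0) s = s"
proof -
  have "s \<in> {0..1}" "s \<in> {1/2..1}"
    using assms by (auto simp: x1_like_def)
  moreover have "(1 + s) / 2 \<in> {(3 + \<tau>) / 4..1}"
    using assms by (auto simp: x1_like_def)
  then have "y ((1 + s) / 2) = 2 * ((1 + s) / 2) - 1"
    using assms(1) unfolding x1_like_def by blast
  ultimately show ?thesis
    using assms by (simp add: thompson_mult_apply inv_thompson_x0_apply x1_like_def field_simps)
qed

lemma thompson_conj_apply:
  assumes f: "f \<in> carrier thompson_F" and y: "y \<in> carrier thompson_F" and s: "s \<in> {0..1}"
    and "y (f s) = f s"
  shows "(inv\<^bsub>thompson_F\<^esub> f \<otimes>\<^bsub>thompson_F\<^esub> y \<otimes>\<^bsub>thompson_F\<^esub> f) s = s"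
  using assms thompson_range[OF f s] thompson_range[OF y, of "f s"]
  by (simp add: thompson_mult_apply thompson_inv_apply)

text \<open>The supports are separated by \<open>z\<close>, the point that x_0 sends to
  \<open>\<tau>\<close>. Above \<open>z\<close> the quotient of \<open>y\<close> by x_0 is the
  identity; below \<open>z\<close> both conjugates of \<open>y\<close> are, since x_0 maps
  \<open>{0..z}\<close> into \<open>{0..\<tau>}\<close>, where \<open>y\<close> is the
  identity.\<close>

lemma x1_like_pair:
  assumes "x1_like \<tau> y"
  shows "thompson_pair thompson_F thompson_x0 y"
proof
  have y: "y \<in> carrier thompson_F" and \<tau>: "1/2 \<le> \<tau>" "\<tau> < 1" and id: "\<And>s. s \<in> {0..\<tau>} \<Longrightarrow> y s = s"
    using assms by (auto simp: x1_like_def)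
  let ?a = thompson_x0
  define z where "z = (1 + \<tau>) / 2"
  have z: "z \<in> {0..1}" "?a z = \<tau>"
    using \<tau> by (auto simp: z_def thompson_x0_def field_simps)
  let ?a' = "inv\<^bsub>thompson_F\<^esub> ?a"
  let ?y' = "?a' \<otimes>\<^bsub>thompson_F\<^esub> y \<otimes>\<^bsub>thompson_F\<^esub> ?a"
  have as: "?a s \<in> {0..\<tau>}" "s \<in> {0..1}" if s: "s \<in> {0..z}" for s
  proof -
    show "s \<in> {0..1}"
      using s z by auto
    then show "?a s \<in> {0..\<tau>}"
      using thompson_le_iff[OF thompson_x0_mem, of s z] thompson_range[OF thompson_x0_mem, of s] s z
      by auto
  qed
  have y': "?y' s = s" if "s \<in> {0..z}" for s
    using as[OF that] id y by (intro thompson_conj_apply) auto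
  moreover have "(?a' \<otimes>\<^bsub>thompson_F\<^esub> ?y' \<otimes>\<^bsub>thompson_F\<^esub> ?a) s = s" if "s \<in> {0..z}" for s
  proof (rule thompson_conj_apply)
    have "?a s \<in> {0..z}"
      using as(1)[OF that] \<tau> by (auto simp: z_def)
    then show "?y' (?a s) = ?a s"
      by (rule y')
  qed (use as[OF that] y in auto)
  moreover have "(y \<otimes>\<^bsub>thompson_F\<^esub> ?a') s = s" if "s \<in> {z..1}" for s
    using x1_like_mult_inv_x0[OF assms] that by (simp add: z_def)
  ultimately show "(y \<otimes>\<^bsub>thompson_F\<^esub> ?a') \<otimes>\<^bsub>thompson_F\<^esub> ?y' = ?y' \<otimes>\<^bsub>thompson_F\<^esub> (y \<otimes>\<^bsub>thompson_F\<^esub> ?a')"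
    "(y \<otimes>\<^bsub>thompson_F\<^esub> ?a') \<otimes>\<^bsub>thompson_F\<^esub> (?a' \<otimes>\<^bsub>thompson_F\<^esub> ?y' \<otimes>\<^bsub>thompson_F\<^esub> ?a) =
     (?a' \<otimes>\<^bsub>thompson_F\<^esub> ?y' \<otimes>\<^bsub>thompson_F\<^esub> ?a) \<otimes>\<^bsub>thompson_F\<^esub> (y \<otimes>\<^bsub>thompson_F\<^esub> ?a')"
    using z(1) y by (intro thompson_commute[of _ _ z]; simp)+
qed (use assms in \<open>auto simp: x1_like_def\<close>)

text \<open>A backward orbit of x_0: it starts at \<open>\<tau>\<close>, x_0 maps each point to its
  predecessor, and the points increase to 1.\<close>

definition test_point :: "real \<Rightarrow> nat \<Rightarrow> real" where
  "test_point \<tau> k = 1 - (1 - \<tau>) / 2 ^ k"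

lemma test_point_mem:
  assumes "\<tau> \<in> {1/2..<1}"
  shows "test_point \<tau> k \<in> {1/2..<1}"
proof -
  define e where "e = (1 - \<tau>) / 2 ^ k"
  have "e \<le> (1 - \<tau>) / 1"
    unfolding e_def using assms by (intro divide_left_mono) auto
  moreover have "0 < e"
    using assms by (simp add: e_def)
  ultimately show ?thesis
    using assms by (simp add: test_point_def e_def[symmetric])
qed

text \<open>Conjugation by x_0 shifts the index of the generator and that of the point together. The
  first claim thus reduces to \<open>\<tau>\<close>, which all \<open>X (Suc m)\<close> fix; the
  second reduces to \<open>y\<close>, the generator of index 1, except that x_0 itself moves every
  point of the open interval down.\<close>

lemma x1_like_test_points:
  assumes "x1_like \<tau> y"
  shows "k < n \<Longrightarrow> thompson_pair.X thompson_F thompson_x0 y n (test_point \<tau> k) = test_point \<tau> k"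
    and "thompson_pair.X thompson_F thompson_x0 y k (test_point \<tau> k) < test_point \<tau> k"
proof -
  interpret TP: thompson_pair thompson_F thompson_x0 y
    by (rule x1_like_pair[OF assms])
  define \<theta> where "\<theta> = test_point \<tau>"
  have \<theta>_eq: "\<theta> k = 1 - (1 - \<tau>) / 2 ^ k" for k
    by (simp add: \<theta>_def test_point_def)
  have y: "y \<in> carrier thompson_F" and \<tau>: "1/2 \<le> \<tau>" "\<tau> < 1" and id: "\<And>s. s \<in> {0..\<tau>} \<Longrightarrow> y s = s"
    and lin: "\<And>s. s \<in> {(3 + \<tau>) / 4..1} \<Longrightarrow> y s = 2 * s - 1"
    using assms by (auto simp: x1_like_def)
  have \<theta>: "\<theta> k \<in> {0..1}" "\<theta> k < 1" "1/2 \<le> \<theta> k" for k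
    using test_point_mem[of \<tau> k] \<tau> by (auto simp: \<theta>_def)
  have \<theta>_less: "\<theta> k < \<theta> (Suc k)" for k
    using \<tau> by (simp add: \<theta>_eq field_simps)
  have \<theta>_mono: "\<theta> k \<le> \<theta> l" if "k \<le> l" for k l
    by (rule lift_Suc_mono_le[of \<theta>, OF less_imp_le[OF \<theta>_less] that])
  have a: "thompson_x0 (\<theta> (Suc k)) = \<theta> k" for k
  proof -
    have e: "\<theta> (Suc k) = (1 + \<theta> k) / 2"
      by (simp add: \<theta>_eq field_simps)
    have "3/4 \<le> \<theta> (Suc k)"
      unfolding e using \<theta>(3)[of k] by simp
    then show ?thesis
      using thompson_x0_apply(3)[OF \<theta>(1)[of "Suc k"]] by (simp add: e field_simps)
  qed
  have y_lin: "y (\<theta> (Suc (Suc l))) = \<theta> (Suc l)" for l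
  proof -
    have "(3 + \<tau>) / 4 = \<theta> 2"
      by (simp add: \<theta>_eq field_simps)
    also have "\<theta> 2 \<le> \<theta> (Suc (Suc l))"
      by (intro \<theta>_mono) simp
    finally show ?thesis
      using lin[of "\<theta> (Suc (Suc l))"] \<theta>(2)[of "Suc (Suc l)"] by (simp add: \<theta>_eq field_simps)
  qed
  have step: "TP.X (Suc (Suc n)) (\<theta> (Suc k)) =
      (inv\<^bsub>thompson_F\<^esub> thompson_x0) (TP.X (Suc n) (\<theta> k))" for n k
  proof -
    have "TP.X (Suc (Suc n)) = inv\<^bsub>thompson_F\<^esub> thompson_x0 \<otimes>\<^bsub>thompson_F\<^esub> TP.X (Suc n) \<otimes>\<^bsub>thompson_F\<^esub> thompson_x0"
      by simp
    then show ?thesis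
      using thompson_range[OF TP.X_closed[of "Suc n"] \<theta>(1)[of k]] \<theta>(1)[of k] \<theta>(1)[of "Suc k"]
      by (simp add: thompson_mult_apply a del: TP.X.simps)
  qed
  have inv_a: "(inv\<^bsub>thompson_F\<^esub> thompson_x0) (\<theta> k) = \<theta> (Suc k)" for k
    using thompson_inv_apply(2)[OF thompson_x0_mem \<theta>(1)[of "Suc k"]] by (simp add: a)
  have inv_a_less: "(inv\<^bsub>thompson_F\<^esub> thompson_x0) s < \<theta> (Suc k) \<longleftrightarrow> s < \<theta> k" if "s \<in> {0..1}" for s k
    using thompson_less_iff[OF TF.inv_closed[OF thompson_x0_mem] that \<theta>(1)[of k]] by (simp add: inv_a)
  have below: "TP.X (Suc m) s = s" if "s \<in> {0..\<tau>}" for s m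
    using that
  proof (induction m arbitrary: s)
    case 0
    then show ?case
      using id by simp
  next
    case (Suc m)
    have s: "s \<in> {0..1}"
      using Suc.prems \<tau> by auto
    have "thompson_x0 s \<in> {0..\<tau>}"
      using thompson_x0_apply(1)[OF s] thompson_range[OF thompson_x0_mem s] Suc.prems by auto
    from Suc.IH[OF this] show ?case
      using thompson_conj_apply[OF thompson_x0_mem TP.X_closed[of "Suc m"] s] by simp
  qed
  have fix_Suc: "TP.X (Suc m) (\<theta> k) = \<theta> k" if "k \<le> m" for k m
    using that
  proof (induction k arbitrary: m)
    case 0
    then show ?case
      using below[of \<tau> m] \<tau> by (simp add: \<theta>_eq del: TP.X.simps)
  next
    case (Suc k)
    then obtain l where "m = Suc l"
      using Suc_le_D by blast
    then show ?case
      using step[of l k] Suc inv_a by (simp del: TP.X.simps)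
  qed
  have less_Suc: "TP.X (Suc m) (\<theta> (Suc l)) < \<theta> (Suc l)" if "m \<le> l" for m l
    using that
  proof (induction m arbitrary: l)
    case 0
    \<comment> \<open>The point with index 1 lies outside the range where \<open>y\<close> is given
      by a formula. So \<open>y\<close> is evaluated at the next test point, which it sends to the
      present one, and monotonicity does the rest.\<close>
    show ?case
      using thompson_less_iff[OF y \<theta>(1)[of "Suc l"] \<theta>(1)[of "Suc (Suc l)"]] \<theta>_less[of "Suc l"]
      by (simp add: y_lin)
  next
    case (Suc m)
    then obtain l' where l': "l = Suc l'"
      using Suc_le_D by blast
    then have "TP.X (Suc m) (\<theta> (Suc l')) < \<theta> (Suc l')"
      using Suc by simp
    then show ?case
      unfolding l' step
      using inv_a_less[OF thompson_range[OF TP.X_closed \<theta>(1)]] by blast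
  qed
  have less: "TP.X n (\<theta> k) < \<theta> k" if "n \<le> k" for n k
  proof (cases n)
    case 0
    then show ?thesis
      using thompson_x0_apply(2)[OF \<theta>(1)[of k]] \<theta>(2,3)[of k] by simp
  next
    case (Suc m)
    then show ?thesis
      using less_Suc[of m "k - 1"] that by (cases k) (auto simp del: TP.X.simps)
  qed
  show "TP.X n (test_point \<tau> k) = test_point \<tau> k" if "k < n"
    using fix_Suc[of k "n - 1"] that unfolding \<theta>_def
    by (cases n) (auto simp del: TP.X.simps)
  show "TP.X k (test_point \<tau> k) < test_point \<tau> k"
    using less[of k k] unfolding \<theta>_def by simp
qed

section \<open>Faithfulness of a representation in Thompson's group\<close>

locale thompson_rep = thompson_pair +
  fixes \<phi> \<tau>
  assumes hom: "\<phi> \<in> hom G thompson_F" and \<phi>_a: "\<phi> a = thompson_x0" and \<phi>_b: "x1_like \<tau> (\<phi> b)"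
begin

sublocale TP: thompson_pair thompson_F thompson_x0 "\<phi> b"
  by (rule x1_like_pair[OF \<phi>_b])

sublocale \<phi>: group_hom G thompson_F \<phi>
  by (simp add: group_hom_def group_hom_axioms_def is_group TF.is_group hom)

lemma \<phi>_X: "\<phi> (X n) = TP.X n"
proof (induction n)
  case (Suc n)
  then show ?case
    by (cases n) (simp_all add: \<phi>_a)
qed (simp add: \<phi>_a)

lemma \<phi>_pos_apply:
  assumes "s \<in> {0..1}"
  shows "\<phi> (pos (n # L)) s = TP.X n (\<phi> (pos L) s)"
  using assms by (simp add: \<phi>_X thompson_mult_apply del: X.simps TP.X.simps)

text \<open>Letters with index above \<open>k\<close> fix the test point, \<open>X k\<close> lowers
  it, and monotone maps keep it lowered. Hence the action shows whether the least possible index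
  occurs.\<close>

lemma pos_test_points:
  assumes "\<forall>n\<in>set L. k \<le> n"
  shows "\<phi> (pos L) (test_point \<tau> k) \<le> test_point \<tau> k \<and>
    (\<phi> (pos L) (test_point \<tau> k) < test_point \<tau> k \<longleftrightarrow> k \<in> set L)"
  using assms
proof (induction L)
  case Nil
  have "test_point \<tau> k \<in> {0..1}"
    using test_point_mem[of \<tau> k] \<phi>_b by (auto simp: x1_like_def)
  then show ?case
    by (simp add: thompson_one_apply)
next
  case (Cons n L)
  define \<theta> where "\<theta> = test_point \<tau>"
  have \<theta>: "\<theta> k \<in> {0..1}"
    using test_point_mem[of \<tau> k] \<phi>_b by (auto simp: x1_like_def \<theta>_def)
  define r where "r = \<phi> (pos L) (\<theta> k)"
  have r: "r \<in> {0..1}"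
    unfolding r_def by (rule thompson_range) (use \<theta> in auto)
  have IH: "r \<le> \<theta> k" "r < \<theta> k \<longleftrightarrow> k \<in> set L"
    using Cons by (auto simp: r_def \<theta>_def)
  note X = x1_like_test_points[OF \<phi>_b, folded \<theta>_def]
  have mono: "TP.X n r < TP.X n (\<theta> k) \<longleftrightarrow> r < \<theta> k" "TP.X n r \<le> TP.X n (\<theta> k) \<longleftrightarrow> r \<le> \<theta> k"
    using thompson_less_iff[OF TP.X_closed r \<theta>] thompson_le_iff[OF TP.X_closed r \<theta>] by auto
  have "TP.X n r \<le> \<theta> k \<and> (TP.X n r < \<theta> k \<longleftrightarrow> n = k \<or> r < \<theta> k)"
  proof (cases "n = k")
    case True
    then show ?thesis
      using X(2)[of k] mono IH by auto
  next
    case False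
    then have "TP.X n (\<theta> k) = \<theta> k"
      using X(1)[of k n] Cons.prems by simp
    then show ?thesis
      using mono IH False by simp
  qed
  then show ?case
    using IH(2) unfolding \<theta>_def[symmetric] \<phi>_pos_apply[OF \<theta>] r_def[symmetric] by auto
qed

text \<open>The least index in the two words is visible in their common image, so it occurs in both.
  It can then be moved to the front of both and cancelled, which shortens \<open>L\<close>.\<close>

lemma pos_inj: "\<phi> (pos L) = \<phi> (pos M) \<Longrightarrow> pos L = pos M"
proof (induction "length L" arbitrary: L M rule: less_induct)
  case less
  show ?case
  proof (cases "set L \<union> set M = {}")
    case False
    define k where "k = Min (set L \<union> set M)"
    have k: "k \<in> set L \<union> set M" "\<forall>n\<in>set L. k \<le> n" "\<forall>n\<in>set M. k \<le> n"
      unfolding k_def using False Min_in[of "set L \<union> set M"] by auto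
    then have "k \<in> set L" "k \<in> set M"
      using pos_test_points[OF k(2)] pos_test_points[OF k(3)] less.prems by auto
    then obtain L' M' where L': "length L = Suc (length L')" "pos L = X k \<otimes> pos L'"
      and M': "pos M = X k \<otimes> pos M'"
      using extract_min k by metis
    have "\<phi> (X k) \<otimes>\<^bsub>thompson_F\<^esub> \<phi> (pos L') = \<phi> (X k) \<otimes>\<^bsub>thompson_F\<^esub> \<phi> (pos M')"
      using less.prems unfolding L' M' by simp
    then have "\<phi> (pos L') = \<phi> (pos M')"
      by (metis TF.Units_eq TF.Units_l_cancel X_closed \<phi>.hom_closed pos_closed)
    then show ?thesis
      using less.hyps[of L' M'] L' M' by simp
  qed simp
qed

lemma word_eval_faithful:
  assumes "v \<in> words 2" "\<phi> (word_eval G [a, b] v) = \<one>\<^bsub>thompson_F\<^esub>"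
  shows "word_eval G [a, b] v = \<one>"
proof -
  have g: "word_eval G [a, b] v \<in> carrier G"
    using word_eval_closed[of "[a, b]" 2 v] assms(1) by simp
  obtain p q where pq: "word_eval G [a, b] v \<otimes> pos q = pos p"
    using word_eval_fraction[OF assms(1)] by blast
  then have "\<phi> (pos q) = \<phi> (pos p)"
    using g assms(2) by (metis TF.l_one \<phi>.hom_closed \<phi>.hom_mult pos_closed)
  then have "pos q = pos p"
    by (rule pos_inj)
  then show ?thesis
    using pq g by (metis pos_closed r_cancel_one)
qed

end

text \<open>No homomorphism from \<open>H\<close> to F is at hand, so the argument takes place in
  the direct product. The pairs of generators form a Thompson pair there, and the projection to F is
  faithful on the words in them; projecting to \<open>H\<close> then gives the claim.\<close>

lemma thompson_presentation:
  assumes "thompson_pair H \<alpha> \<beta>" "x1_like \<tau> y" "v \<in> words 2"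
    and "word_eval thompson_F [thompson_x0, y] v = \<one>\<^bsub>thompson_F\<^esub>"
  shows "word_eval H [\<alpha>, \<beta>] v = \<one>\<^bsub>H\<^esub>"
proof -
  interpret H: thompson_pair H \<alpha> \<beta> by fact
  interpret Y: thompson_pair thompson_F thompson_x0 y
    by (rule x1_like_pair) fact
  let ?K = "H \<times>\<times> thompson_F"
  interpret K: group ?K
    by (intro DirProd_group H.is_group TF.is_group)
  have hom: "fst \<in> hom ?K H" "snd \<in> hom ?K thompson_F"
    by (auto simp: hom_def mult_DirProd')
  interpret K: thompson_rep ?K "(\<alpha>, thompson_x0)" "(\<beta>, y)" snd \<tau>
    using H.rel1 H.rel2 Y.rel1 Y.rel2 assms(2) hom
    by unfold_locales (simp_all add: H.is_group TF.is_group del: One_nat_def)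
  have ev: "word_eval H (map fst [(\<alpha>, thompson_x0), (\<beta>, y)]) v =
      fst (word_eval ?K [(\<alpha>, thompson_x0), (\<beta>, y)] v)"
    "word_eval thompson_F (map snd [(\<alpha>, thompson_x0), (\<beta>, y)]) v =
      snd (word_eval ?K [(\<alpha>, thompson_x0), (\<beta>, y)] v)"
    by (rule word_eval_hom[OF K.is_group _ _ _ _ assms(3)];
        use hom H.is_group TF.is_group in auto)+
  then have "word_eval ?K [(\<alpha>, thompson_x0), (\<beta>, y)] v = \<one>\<^bsub>?K\<^esub>"
    using K.word_eval_faithful[OF assms(3)] assms(4) by simp
  then show ?thesis
    using ev(1) by simp
qed

section \<open>Evaluation of words\<close>

definition word_subst :: "word list \<Rightarrow> word \<Rightarrow> word" where
  "word_subst \<sigma> v = concat (map (\<lambda>(i, e). if e then \<sigma> ! i else winv (\<sigma> ! i)) v)"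

lemma word_subst_words:
  assumes "set \<sigma> \<subseteq> words k" "v \<in> words (length \<sigma>)"
  shows "word_subst \<sigma> v \<in> words k"
  using assms(2)
proof (induction v)
  case (Cons x v)
  then have "\<sigma> ! fst x \<in> words k"
    using assms(1) by (simp add: subset_iff)
  with Cons show ?case
    by (cases x) (auto simp: word_subst_def)
qed (simp add: word_subst_def)

lemma wpow_words: "u \<in> words k \<Longrightarrow> wpow u i \<in> words k"
proof -
  assume u: "u \<in> words k"
  have "concat (replicate n v) \<in> words k" if "v \<in> words k" for n v
    using that by (induction n) auto
  then show ?thesis
    using u by (simp add: wpow_def)
qed

lemma wcomm_words: "u \<in> words k \<Longrightarrow> v \<in> words k \<Longrightarrow> wcomm u v \<in> words k"
  by (simp add: wcomm_def)

lemma thompson_relators_words: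
  assumes "x \<in> words k" "y \<in> words k"
  shows "thompson_relators x y \<subseteq> words k"
  using assms by (simp add: thompson_relators_def wcomm_words wpow_words)

lemma (in group) word_eval_cong:
  assumes "v \<in> words k" "\<And>i. i < k \<Longrightarrow> S ! i = T ! i"
  shows "word_eval G S v = word_eval G T v"
  using assms by (induction v) auto

lemma (in group) word_eval_subst:
  assumes "length S = k" "set S \<subseteq> carrier G" "set \<sigma> \<subseteq> words k" "v \<in> words (length \<sigma>)"
  shows "word_eval G (map (word_eval G S) \<sigma>) v = word_eval G S (word_subst \<sigma> v)"
  using assms(4)
proof (induction v)
  case (Cons x v)
  then have "\<sigma> ! fst x \<in> words k" "word_subst \<sigma> v \<in> words k"
    using assms(3) word_subst_words by (simp_all add: subset_iff)
  moreover have "word_subst \<sigma> (x # v) = (if snd x then \<sigma> ! fst x else winv (\<sigma> ! fst x)) @ word_subst \<sigma> v"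
    by (simp add: word_subst_def split_def)
  ultimately show ?case
    using Cons by (simp add: word_eval_append[OF assms(1,2)] word_eval_winv[OF assms(1,2)])
qed (simp add: word_subst_def)

lemma (in group) word_eval_wpow:
  assumes "length S = k" "set S \<subseteq> carrier G" "u \<in> words k"
  shows "word_eval G S (wpow u i) = word_eval G S u [^] (i :: int)"
proof -
  note closed = word_eval_closed[OF assms(1,2)]
  have nat_pow: "word_eval G S (concat (replicate n v)) = word_eval G S v [^] n"
    if v: "v \<in> words k" for n v
  proof (induction n)
    case (Suc n)
    have "concat (replicate n v) \<in> words k"
      using v by (induction n) auto
    then show ?case
      using Suc v closed nat_pow_Suc2[OF closed[OF v], of n]
      by (simp add: word_eval_append[OF assms(1,2)])
  qed simp
  show ?thesis
    using assms(3) closed[OF assms(3)]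
    by (auto simp: wpow_def nat_pow word_eval_winv[OF assms(1,2)] int_pow_def2 nat_pow_inv simp del: pow_nat)
qed

lemma (in group) word_eval_wcomm_eq_one_iff:
  assumes "length S = k" "set S \<subseteq> carrier G" "u \<in> words k" "v \<in> words k"
  shows "word_eval G S (wcomm u v) = \<one> \<longleftrightarrow>
    word_eval G S u \<otimes> word_eval G S v = word_eval G S v \<otimes> word_eval G S u"
proof -
  have "word_eval G S (wcomm u v) = word_eval G S u \<otimes> (word_eval G S v \<otimes>
      (inv (word_eval G S u) \<otimes> inv (word_eval G S v)))"
    using assms(3,4)
    by (simp add: wcomm_def word_eval_append[OF assms(1,2)] word_eval_winv[OF assms(1,2)])
  then show ?thesis
    using commutator_eq_one_iff word_eval_closed[OF assms(1,2)] assms(3,4) by simp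
qed

lemma (in group) thompson_relators_iff:
  assumes "length S = k" "set S \<subseteq> carrier G" "i < k" "j < k"
  shows "(\<forall>r\<in>thompson_relators [(i, True)] [(j, True)]. word_eval G S r = \<one>) \<longleftrightarrow>
    thompson_pair G (S ! i) (S ! j)"
proof -
  have ij: "S ! i \<in> carrier G" "S ! j \<in> carrier G"
    using assms by auto
  have ev: "word_eval G S [(i, True)] = S ! i" "word_eval G S [(j, True)] = S ! j"
    using ij by simp_all
  have w: "[(i, True)] \<in> words k" "[(j, True)] \<in> words k"
    using assms by simp_all
  have pow: "S ! i [^] (-1 :: int) = inv (S ! i)" "S ! i [^] (2 :: int) = S ! i \<otimes> S ! i"
    "S ! i [^] (-2 :: int) = inv (S ! i) \<otimes> inv (S ! i)"
    using ij by (simp_all add: int_pow_def2 numeral_2_eq_2 inv_mult_group del: pow_nat)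
  show ?thesis
    using ij w
    by (simp add: thompson_relators_def word_eval_wcomm_eq_one_iff[OF assms(1,2)] wpow_words
        word_eval_append[OF assms(1,2)] word_eval_wpow[OF assms(1,2)] ev pow
        thompson_pair_def thompson_pair_axioms_def is_group m_assoc)
qed

lemma (in group) conj_relator_iff:
  assumes "length S = k" "set S \<subseteq> carrier G" "i < k" "j < k" "l < k"
  shows "word_eval G S (wcomm ([(j, True)] @ wpow [(i, True)] (-1))
      (wpow [(i, True)] m @ [(l, True)] @ wpow [(i, True)] (- m))) = \<one> \<longleftrightarrow>
    (S ! j \<otimes> inv (S ! i)) \<otimes> (S ! i [^] m \<otimes> S ! l \<otimes> inv (S ! i [^] m)) =
    (S ! i [^] m \<otimes> S ! l \<otimes> inv (S ! i [^] m)) \<otimes> (S ! j \<otimes> inv (S ! i))"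
proof -
  have S: "S ! i \<in> carrier G" "S ! j \<in> carrier G" "S ! l \<in> carrier G"
    using assms by auto
  have w: "[(i, True)] \<in> words k" "[(j, True)] \<in> words k" "[(l, True)] \<in> words k"
    using assms by simp_all
  have ev: "word_eval G S (wpow [(i, True)] n) = S ! i [^] n" for n
    using S word_eval_wpow[OF assms(1,2) w(1)] by simp
  have "word_eval G S ([(j, True)] @ wpow [(i, True)] (-1)) = S ! j \<otimes> inv (S ! i)"
    using S int_pow_neg[of "S ! i" 1] by (simp add: ev)
  moreover have "word_eval G S (wpow [(i, True)] m @ [(l, True)] @ wpow [(i, True)] (- m)) =
      S ! i [^] m \<otimes> S ! l \<otimes> inv (S ! i [^] m)"
    using S w int_pow_neg[of "S ! i" m]
    by (simp add: word_eval_append[OF assms(1,2)] wpow_words ev m_assoc)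
  moreover have "[(j, True)] @ wpow [(i, True)] (-1) \<in> words k"
    "wpow [(i, True)] m @ [(l, True)] @ wpow [(i, True)] (- m) \<in> words k"
    using w wpow_words by simp_all
  ultimately show ?thesis
    using word_eval_wcomm_eq_one_iff[OF assms(1,2)] by simp
qed

text \<open>This transports relations among several elements given as words in x_0 and
  \<open>y\<close>, such as the triples (x_0, x_1, w_n), (x_0, x_1, 1) and (x_0, x_0, w_n).\<close>

lemma thompson_presentation_subst:
  assumes "thompson_pair H \<alpha> \<beta>" "x1_like \<tau> y" "set \<sigma> \<subseteq> words 2" "v \<in> words (length \<sigma>)"
    and "word_eval thompson_F (map (word_eval thompson_F [thompson_x0, y]) \<sigma>) v = \<one>\<^bsub>thompson_F\<^esub>"
  shows "word_eval H (map (word_eval H [\<alpha>, \<beta>]) \<sigma>) v = \<one>\<^bsub>H\<^esub>"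
proof -
  interpret H: thompson_pair H \<alpha> \<beta> by fact
  have y: "y \<in> carrier thompson_F"
    using assms(2) by (simp add: x1_like_def)
  have "word_eval thompson_F [thompson_x0, y] (word_subst \<sigma> v) = \<one>\<^bsub>thompson_F\<^esub>"
    using TF.word_eval_subst[of "[thompson_x0, y]" 2 \<sigma> v] y assms(3-5) by simp
  then have "word_eval H [\<alpha>, \<beta>] (word_subst \<sigma> v) = \<one>\<^bsub>H\<^esub>"
    by (rule thompson_presentation[OF assms(1,2) word_subst_words[OF assms(3,4)]])
  then show ?thesis
    using H.word_eval_subst[of "[\<alpha>, \<beta>]" 2 \<sigma> v] assms(3,4) by simp
qed


section \<open>Relations of presented groups\<close>

lemma (in group) word_eval_free_rel:
  assumes "length S = k" "set S \<subseteq> carrier G" "(u, v) \<in> free_rel k"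
  shows "word_eval G S u = word_eval G S v"
proof -
  have cancel: "word_eval G S u = word_eval G S v" if uv: "(u, v) \<in> cancellation k" for u v
  proof -
    obtain p q i e where pq: "u = p @ [(i, e), (i, \<not> e)] @ q" "v = p @ q"
      and w: "p \<in> words k" "q \<in> words k" "i < k"
      using uv unfolding cancellation_def by blast
    have "S ! i \<in> carrier G" "word_eval G S q \<in> carrier G"
      using assms(1,2) w word_eval_closed[OF assms(1,2)] by auto
    then have "word_eval G S ([(i, e), (i, \<not> e)] @ q) = word_eval G S q"
      by (simp add: inv_mult_cancel)
    moreover have "[(i, e), (i, \<not> e)] @ q \<in> words k"
      using w by simp
    ultimately show ?thesis
      unfolding pq using w word_eval_append[OF assms(1,2)] by simp
  qed
  have "(u, v) \<in> (cancellation k \<union> (cancellation k)\<inverse>)\<^sup>*"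
    using assms(3) by (simp add: free_rel_def)
  then show ?thesis
    by (induction rule: rtrancl_induct) (auto dest: cancel)
qed

lemma word_eval_free_group:
  assumes "w \<in> words k"
  shows "word_eval (free_group k) (map (\<lambda>i. free_rel k `` {[(i, True)]}) [0..<k]) w = free_rel k `` {w}"
  using assms
proof (induction w)
  case Nil
  then show ?case
    by (simp add: one_free_group)
next
  case (Cons x w)
  obtain i e where x: "x = (i, e)" "i < k"
    using Cons.prems by (cases x) auto
  have "inv\<^bsub>free_group k\<^esub> (free_rel k `` {[(i, True)]}) = free_rel k `` {[(i, False)]}"
  proof (rule group.inv_equality[OF group_free_group])
    have "free_rel k `` {[(i, False), (i, True)]} = free_rel k `` {[]}"
      using free_rel_winv[of "[(i, True)]" k] x by (intro equiv_class_eq[OF equiv_free_rel]) simp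
    then show "free_rel k `` {[(i, False)]} \<otimes>\<^bsub>free_group k\<^esub> free_rel k `` {[(i, True)]} =
        \<one>\<^bsub>free_group k\<^esub>"
      using x by (simp add: mult_free_group one_free_group)
  qed (use x in \<open>auto simp: carrier_free_group\<close>)
  then show ?case
    using Cons x mult_free_group[of "[x]" k w] by (cases e) simp_all
qed

lemma marked_relations_presented_group:
  assumes "R \<subseteq> words k"
  shows "marked_relations k (presented_group k R) =
    {w \<in> words k. free_rel k `` {w} \<in> normal_closure (free_group k) ((\<lambda>r. free_rel k `` {r}) ` R)}"
proof -
  define F where "F = free_group k"
  define N where "N = normal_closure F ((\<lambda>r. free_rel k `` {r}) ` R)"
  define S where "S = map (\<lambda>i. free_rel k `` {[(i, True)]}) [0..<k]"
  interpret F: group F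
    unfolding F_def by (rule group_free_group)
  have "N \<lhd> F"
    unfolding N_def using assms
    by (intro normal_closure_normal F.is_group) (auto simp: F_def carrier_free_group)
  then interpret N: normal N F .
  have "word_eval (F Mod N) (map (\<lambda>x. N #>\<^bsub>F\<^esub> x) S) w = \<one>\<^bsub>F Mod N\<^esub> \<longleftrightarrow> free_rel k `` {w} \<in> N"
    if w: "w \<in> words k" for w
  proof -
    have c: "free_rel k `` {w} \<in> carrier F"
      using w by (simp add: F_def carrier_free_group)
    have S: "length S = k" "set S \<subseteq> carrier F"
      by (auto simp: S_def F_def carrier_free_group)
    have "word_eval (F Mod N) (map (\<lambda>x. N #>\<^bsub>F\<^esub> x) S) w = N #>\<^bsub>F\<^esub> word_eval F S w"
      by (rule word_eval_hom[OF F.is_group N.factorgroup_is_group N.r_coset_hom_Mod S w])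
    also have "word_eval F S w = free_rel k `` {w}"
      unfolding F_def S_def by (rule word_eval_free_group[OF w])
    finally show ?thesis
      using F.coset_join1[OF _ c N.is_subgroup] F.coset_join2[OF c N.is_subgroup] by auto
  qed
  then show ?thesis
    by (auto simp: marked_relations_def presented_group_def Let_def F_def N_def S_def comp_def)
qed

lemma relators_subset_marked_relations:
  assumes "R \<subseteq> words k"
  shows "R \<subseteq> marked_relations k (presented_group k R)"
proof
  fix r assume r: "r \<in> R"
  interpret F: group "free_group k"
    by (rule group_free_group)
  have c: "free_rel k `` {r} \<in> carrier (free_group k)"
    using r assms by (auto simp: carrier_free_group)
  have "free_rel k `` {r} = \<one>\<^bsub>free_group k\<^esub> \<otimes>\<^bsub>free_group k\<^esub> free_rel k `` {r} \<otimes>\<^bsub>free_group k\<^esub>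
      inv\<^bsub>free_group k\<^esub> \<one>\<^bsub>free_group k\<^esub>"
    using c by simp
  then have "free_rel k `` {r} \<in> normal_closure (free_group k) ((\<lambda>r. free_rel k `` {r}) ` R)"
    unfolding normal_closure_def using r F.one_closed by (intro generate.incl) blast
  then show "r \<in> marked_relations k (presented_group k R)"
    using r assms unfolding marked_relations_presented_group[OF assms] by blast
qed

lemma presented_group_3:
  assumes "R \<subseteq> words 3"
  obtains A a b c where "presented_group 3 R = (A, [a, b, c])" "group A"
    "a \<in> carrier A" "b \<in> carrier A" "c \<in> carrier A"
    "\<And>r. r \<in> R \<Longrightarrow> word_eval A [a, b, c] r = \<one>\<^bsub>A\<^esub>"
proof -
  obtain A L where L: "presented_group 3 R = (A, L)"
    by (cases "presented_group 3 R")
  note marked_groupsD[OF presented_group_marked[OF assms, unfolded L]]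
  moreover from this obtain a b c where "L = [a, b, c]"
    by (auto simp: numeral_3_eq_3 length_Suc_conv)
  moreover have "word_eval A L r = \<one>\<^bsub>A\<^esub>" if "r \<in> R" for r
    using relators_subset_marked_relations[OF assms] that
    by (auto simp: marked_relations_def L)
  ultimately show ?thesis
    using L that by simp
qed

text \<open>For a constant family this is von Dyck's theorem; in general it holds because a relation
  is a consequence of finitely many relators.\<close>

lemma eventually_presented_relation:
  assumes H: "group H" and S: "\<And>n. length (S n) = k" "\<And>n. set (S n) \<subseteq> carrier H"
    and R: "R \<subseteq> words k" "\<And>r. r \<in> R \<Longrightarrow> \<forall>\<^sub>F n in net. word_eval H (S n) r = \<one>\<^bsub>H\<^esub>"
    and w: "w \<in> marked_relations k (presented_group k R)"
  shows "\<forall>\<^sub>F n in net. word_eval H (S n) w = \<one>\<^bsub>H\<^esub>"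
proof -
  interpret H: group H by fact
  interpret F: group "free_group k"
    by (rule group_free_group)
  note append = H.word_eval_append[OF S] and winv = H.word_eval_winv[OF S]
    and closed = H.word_eval_closed[OF S]
  define C where "C = (\<lambda>w. free_rel k `` {w})"
  \<comment> \<open>The classes of words in \<open>E\<close> are shown to contain all conjugates of
    relators and to be closed under products and inverses. Each product combines only two eventual
    statements, so no uniformity over \<open>R\<close> is required.\<close>
  define E where "E = {w \<in> words k. \<forall>\<^sub>F n in net. word_eval H (S n) w = \<one>\<^bsub>H\<^esub>}"
  have E_class: "v \<in> E" if v: "C v \<in> C ` E" "v \<in> words k" for v
  proof -
    obtain u where u: "u \<in> E" "C v = C u"
      using v by blast
    then have "(u, v) \<in> free_rel k"
      using v eq_equiv_class_iff[OF equiv_free_rel, of u k v] by (auto simp: C_def E_def)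
    then have "word_eval H (S n) u = word_eval H (S n) v" for n
      by (rule H.word_eval_free_rel[OF S])
    then show ?thesis
      using u v by (simp add: E_def)
  qed
  have E_winv: "winv u \<in> E" if "u \<in> E" for u
    using that by (auto simp: E_def winv elim: eventually_mono)
  have E_append: "u @ v \<in> E" if "u \<in> E" "v \<in> E" for u v
    using that by (auto simp: E_def append elim: eventually_elim2)
  have C_append: "C u \<otimes>\<^bsub>free_group k\<^esub> C v = C (u @ v)" if "u \<in> words k" "v \<in> words k" for u v
    using that by (simp add: C_def mult_free_group)
  have C_winv: "inv\<^bsub>free_group k\<^esub> (C u) = C (winv u)" if "u \<in> words k" for u
  proof (rule F.inv_equality)
    show "C (winv u) \<otimes>\<^bsub>free_group k\<^esub> C u = \<one>\<^bsub>free_group k\<^esub>"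
      using that free_rel_winv[OF that] equiv_class_eq[OF equiv_free_rel]
      by (simp add: C_append one_free_group) (simp add: C_def)
  qed (use that in \<open>simp_all add: C_def carrier_free_group\<close>)
  have conj: "g \<otimes>\<^bsub>free_group k\<^esub> C r \<otimes>\<^bsub>free_group k\<^esub> inv\<^bsub>free_group k\<^esub> g \<in> C ` E"
    if g: "g \<in> carrier (free_group k)" and r: "r \<in> R" for g r
  proof -
    obtain u where u: "u \<in> words k" "g = C u"
      using g by (auto simp: C_def carrier_free_group)
    have "r \<in> words k"
      using r R(1) by blast
    then have "u @ r @ winv u \<in> E"
      using u R(2)[OF r] by (auto simp: E_def append winv closed elim: eventually_mono)
    moreover have "g \<otimes>\<^bsub>free_group k\<^esub> C r \<otimes>\<^bsub>free_group k\<^esub> inv\<^bsub>free_group k\<^esub> g = C (u @ r @ winv u)"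
      using u \<open>r \<in> words k\<close> by (simp add: C_append C_winv)
    ultimately show ?thesis
      by simp
  qed
  have "X \<in> C ` E" if "X \<in> normal_closure (free_group k) (C ` R)" for X
    using that unfolding normal_closure_def
  proof (induction rule: generate.induct)
    case one
    have "[] \<in> E"
      by (simp add: E_def)
    then show ?case
      by (auto simp: one_free_group C_def)
  next
    case (incl h)
    then show ?case
      using conj by blast
  next
    case (inv h)
    then obtain u where "u \<in> E" "h = C u"
      using conj by blast
    then have "inv\<^bsub>free_group k\<^esub> h = C (winv u)"
      by (intro trans[OF _ C_winv]) (auto simp: E_def)
    then show ?case
      using E_winv \<open>u \<in> E\<close> by blast
  next
    case (eng g h)
    then obtain u v where "u \<in> E" "g = C u" "v \<in> E" "h = C v"
      by blast
    moreover from this have "g \<otimes>\<^bsub>free_group k\<^esub> h = C (u @ v)"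
      by (simp add: C_append E_def)
    ultimately show ?case
      using E_append by blast
  qed
  moreover have "w \<in> words k" "C w \<in> normal_closure (free_group k) (C ` R)"
    using w unfolding marked_relations_presented_group[OF R(1)] C_def by simp_all
  ultimately have "w \<in> E"
    using E_class by blast
  then show ?thesis
    by (simp add: E_def)
qed


section \<open>Convergence of marked groups\<close>

text \<open>There are only finitely many words of length at most \<open>R\<close>, so eventual
  agreement on each single word gives eventual agreement on the whole ball. The chosen
  representatives of the classes have the same relations as the given groups.\<close>

lemma limitin_marked_class:
  fixes M :: "'i \<Rightarrow> 'g marked"
  assumes N: "N \<in> marked_groups k" and M: "\<forall>\<^sub>F n in net. M n \<in> marked_groups k"
    and rel: "\<And>w. w \<in> words k \<Longrightarrow>
      \<forall>\<^sub>F n in net. w \<in> marked_relations k (M n) \<longleftrightarrow> w \<in> marked_relations k N"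
  shows "limitin (marked_topology k) (\<lambda>n. marked_class k (M n)) (marked_class k N) net"
proof -
  have rep: "marked_relations k (SOME Q. Q \<in> marked_class k P) = marked_relations k P"
    if "P \<in> marked_groups k" for P :: "'g marked"
  proof -
    have "P \<in> marked_class k P"
      unfolding marked_class_def using equiv_class_self[OF equiv_marked_iso that] .
    then have "(SOME Q. Q \<in> marked_class k P) \<in> marked_class k P"
      by (rule someI)
    then have "(P, SOME Q. Q \<in> marked_class k P) \<in> marked_iso k"
      by (simp add: marked_class_def)
    moreover from this have "(SOME Q. Q \<in> marked_class k P) \<in> marked_groups k"
      by (auto simp: marked_iso_def)
    ultimately show ?thesis
      using marked_iso_iff[OF that] by blast
  qed
  have mem: "marked_class k P \<in> marked_space k" if "P \<in> marked_groups k" for P :: "'g marked"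
    using that by (auto simp: marked_class_def marked_space_def quotientI)
  have "\<forall>\<^sub>F n in net. marked_class k (M n) \<in> marked_space k \<and>
      marked_space_dist k (marked_class k (M n)) (marked_class k N) < \<epsilon>" if "0 < \<epsilon>" for \<epsilon>
  proof -
    obtain R :: nat where "- ln \<epsilon> < real R"
      using reals_Archimedean2 by blast
    then have "exp (- real R) < exp (ln \<epsilon>)"
      by simp
    then have R: "exp (- real R) < \<epsilon>"
      using that by simp
    have "finite ({..<k} \<times> (UNIV :: bool set))"
      by simp
    from finite_lists_length_le[OF this, of R] have "finite {w \<in> words k. length w \<le> R}"
      by (simp add: words_def lists_eq_set)
    then have "\<forall>\<^sub>F n in net. \<forall>w\<in>{w \<in> words k. length w \<le> R}.
        w \<in> marked_relations k (M n) \<longleftrightarrow> w \<in> marked_relations k N"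
      using rel by (intro eventually_ball_finite) auto
    with M show ?thesis
    proof eventually_elim
      case (elim n)
      \<comment> \<open>The distance quantifies over all lists; one with a letter out of range is a
        relation of neither group.\<close>
      have "w \<in> marked_relations k (M n) \<longleftrightarrow> w \<in> marked_relations k N" if "length w \<le> R" for w
        using elim(2) that by (cases "w \<in> words k") (auto simp: marked_relations_def)
      then have "marked_dist k (M n) N \<le> exp (- real R)"
        unfolding marked_dist_le_iff by blast
      moreover have "marked_space_dist k (marked_class k (M n)) (marked_class k N) = marked_dist k (M n) N"
        unfolding marked_space_dist_def marked_dist_def rep[OF elim(1)] rep[OF N] ..
      ultimately show ?case
        using R mem[OF elim(1)] by simp
    qed
  qed
  then show ?thesis
    unfolding marked_topology_def Metric_space.limitin_metric[OF Metric_space_marked]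
    using mem[OF N] by blast
qed

section \<open>The limit group\<close>

text \<open>The quotient \<open>D v\<close> of the first two factors lies in the centraliser
  \<open>P\<close> of all conjugates \<open>C i\<close> of \<open>c\<close>. In particular it
  commutes with \<open>c\<close>, so each letter \<open>c\<close> can be moved past it into the last
  factor.\<close>

lemma (in group) word_eval_split:
  assumes [simp]: "a \<in> carrier G" "b \<in> carrier G" "c \<in> carrier G"
    and comm: "\<And>i :: int. (b \<otimes> inv a) \<otimes> (a [^] i \<otimes> c \<otimes> inv (a [^] i)) =
      (a [^] i \<otimes> c \<otimes> inv (a [^] i)) \<otimes> (b \<otimes> inv a)"
    and w: "w \<in> words 3"
  shows "word_eval G [a, b, c] w =
    word_eval G [a, b, \<one>] w \<otimes> inv (word_eval G [a, a, \<one>] w) \<otimes> word_eval G [a, a, c] w"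
proof -
  define C where "C i = a [^] i \<otimes> c \<otimes> inv (a [^] i)" for i :: int
  define D where "D v = word_eval G [a, b, \<one>] v \<otimes> inv (word_eval G [a, a, \<one>] v)" for v
  \<comment> \<open>Using all integers \<open>i\<close> makes this centraliser invariant under
    conjugation by \<open>a\<close> in both directions. This is what \<open>P_D\<close> requires,
    since a letter \<open>a\<close> conjugates \<open>D v\<close> and a letter \<open>b\<close> also
    multiplies it by \<open>b \<otimes> inv a\<close>, or by a conjugate of its inverse.\<close>
  define P where "P x \<longleftrightarrow> x \<in> carrier G \<and> (\<forall>i. C i \<otimes> x = x \<otimes> C i)" for x
  have closed [simp]: "word_eval G [x, y, z] v \<in> carrier G"
    if "v \<in> words 3" "x \<in> carrier G" "y \<in> carrier G" "z \<in> carrier G" for v x y z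
    using that word_eval_closed[of "[x, y, z]" 3 v] by simp
  have C [simp]: "C i \<in> carrier G" for i
    by (simp add: C_def)
  have C_shift: "a \<otimes> C i \<otimes> inv a = C (1 + i)" for i
    by (simp add: C_def int_pow_mult m_assoc inv_mult_group)
  have C_shift': "inv a \<otimes> C i \<otimes> a = C (i - 1)" for i
  proof -
    have "C i = a \<otimes> C (i - 1) \<otimes> inv a"
      using C_shift[of "i - 1"] by simp
    then show ?thesis
      by (simp add: m_assoc inv_mult_cancel)
  qed
  have conj: "(g \<otimes> x \<otimes> inv g) \<otimes> (g \<otimes> y \<otimes> inv g) = g \<otimes> (x \<otimes> y) \<otimes> inv g"
    if "g \<in> carrier G" "x \<in> carrier G" "y \<in> carrier G" for g x y
    using that by (simp add: m_assoc inv_mult_cancel)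
  have P_mult: "P (x \<otimes> y)" if "P x" "P y" for x y
    using that commute_mult by (simp add: P_def)
  have P_inv: "P (inv x)" if "P x" for x
    using that commute_inv by (simp add: P_def)
  have P_conj: "P (a \<otimes> x \<otimes> inv a)" if "P x" for x
  proof -
    have "C i \<otimes> (a \<otimes> x \<otimes> inv a) = (a \<otimes> x \<otimes> inv a) \<otimes> C i" for i
      using that C_shift[of "i - 1", symmetric] by (simp add: conj P_def)
    then show ?thesis
      using that by (simp add: P_def)
  qed
  have P_conj': "P (inv a \<otimes> x \<otimes> a)" if "P x" for x
  proof -
    have "C i \<otimes> (inv a \<otimes> x \<otimes> a) = (inv a \<otimes> x \<otimes> a) \<otimes> C i" for i
      using that C_shift'[of "i + 1", symmetric] conj[of "inv a"] by (simp add: P_def)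
    then show ?thesis
      using that by (simp add: P_def)
  qed
  have P_d: "P (b \<otimes> inv a)"
    using comm by (simp add: P_def C_def)
  have letters: "x = (0, True) \<or> x = (0, False) \<or> x = (1, True) \<or> x = (1, False) \<or>
      x = (2, True) \<or> x = (2, False)" if "x # v \<in> words 3" for x :: "nat \<times> bool" and v
    using that by (cases x) (auto simp: numeral_3_eq_3 less_Suc_eq)
  have P_D: "P (D v)" if "v \<in> words 3" for v
    using that
  proof (induction v)
    case Nil
    show ?case
      by (simp add: P_def D_def)
  next
    case (Cons x v)
    then have v: "v \<in> words 3" and IH: "P (D v)"
      by simp_all
    consider "x = (0, True)" | "x = (0, False)" | "x = (1, True)" | "x = (1, False)"
      | "x = (2, True) \<or> x = (2, False)"
      using letters[OF Cons.prems] by blast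
    then show ?case
    proof cases
      case 1
      then have "D (x # v) = a \<otimes> D v \<otimes> inv a"
        using v by (simp add: D_def m_assoc inv_mult_group)
      then show ?thesis
        using P_conj[OF IH] by simp
    next
      case 2
      then have "D (x # v) = inv a \<otimes> D v \<otimes> a"
        using v by (simp add: D_def m_assoc inv_mult_group)
      then show ?thesis
        using P_conj'[OF IH] by simp
    next
      case 3
      then have "D (x # v) = (b \<otimes> inv a) \<otimes> (a \<otimes> D v \<otimes> inv a)"
        using v by (simp add: D_def m_assoc inv_mult_group inv_mult_cancel)
      then show ?thesis
        using P_mult[OF P_d P_conj[OF IH]] by simp
    next
      case 4
      then have "D (x # v) = (inv a \<otimes> inv (b \<otimes> inv a) \<otimes> a) \<otimes> (inv a \<otimes> D v \<otimes> a)"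
        using v by (simp add: D_def m_assoc inv_mult_group inv_mult_cancel)
      then show ?thesis
        using P_mult[OF P_conj'[OF P_inv[OF P_d]] P_conj'[OF IH]] by simp
    next
      case 5
      then have "D (x # v) = D v"
        using v by (auto simp: D_def)
      then show ?thesis
        using IH by simp
    qed
  qed
  have "word_eval G [a, b, c] w = D w \<otimes> word_eval G [a, a, c] w"
    using w
  proof (induction w)
    case Nil
    show ?case
      by (simp add: D_def)
  next
    case (Cons x v)
    then have v: "v \<in> words 3" and IH: "word_eval G [a, b, c] v = D v \<otimes> word_eval G [a, a, c] v"
      by simp_all
    have "C 0 = c"
      by (simp add: C_def)
    then have Dc: "c \<otimes> D v = D v \<otimes> c" and D [simp]: "D v \<in> carrier G"
      using P_D[OF v] by (auto simp: P_def)
    have Dc': "inv c \<otimes> D v = D v \<otimes> inv c"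
      using commute_inv[of "D v" c] Dc by simp
    consider "fst x < 2" | "x = (2, True)" | "x = (2, False)"
      using letters[OF Cons.prems] by fastforce
    then show ?case
    proof cases
      case 1
      then have "x = (0, True) \<or> x = (0, False) \<or> x = (1, True) \<or> x = (1, False)"
        using letters[OF Cons.prems] by fastforce
      then show ?thesis
        using v IH by (auto simp: D_def m_assoc inv_mult_group inv_mult_cancel)
    next
      case 2
      then have "D (x # v) = D v"
        using v by (simp add: D_def)
      moreover have "c \<otimes> (D v \<otimes> word_eval G [a, a, c] v) = D v \<otimes> (c \<otimes> word_eval G [a, a, c] v)"
        using Dc v by (simp add: m_assoc[symmetric])
      ultimately show ?thesis
        using 2 IH by simp
    next
      case 3
      then have "D (x # v) = D v"
        using v by (simp add: D_def)
      moreover have "inv c \<otimes> (D v \<otimes> word_eval G [a, a, c] v) = D v \<otimes> (inv c \<otimes> word_eval G [a, a, c] v)"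
        using Dc' v by (simp add: m_assoc[symmetric])
      ultimately show ?thesis
        using 3 IH by simp
    qed
  qed
  then show ?thesis
    by (simp add: D_def)
qed

text \<open>A point below 1 has finitely many images under the suffixes of \<open>w\<close>; once all of them lie
  below \<open>\<tau> n\<close>, the letter \<open>c\<close> has no effect.\<close>

lemma eventually_word_eval_apply:
  assumes \<tau>: "\<tau> \<longlonglongrightarrow> 1" and g: "\<And>n. g n \<in> carrier thompson_F"
    and id: "\<forall>\<^sub>F n in sequentially. \<forall>s\<in>{0..\<tau> n}. g n s = s"
    and w: "w \<in> words 3" and s: "s \<in> {0..<1}"
  shows "\<forall>\<^sub>F n in sequentially. word_eval thompson_F [thompson_x0, thompson_x1, g n] w s =
    word_eval thompson_F [thompson_x0, thompson_x1, \<one>\<^bsub>thompson_F\<^esub>] w s"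
  using w
proof (induction w)
  case (Cons x w)
  then have w: "w \<in> words 3" and i: "fst x = 0 \<or> fst x = 1 \<or> fst x = 2"
    by auto
  have s01: "s \<in> {0..1}"
    using s by simp
  have closed: "word_eval thompson_F [thompson_x0, thompson_x1, h] w \<in> carrier thompson_F"
    if "h \<in> carrier thompson_F" for h
    using that w TF.word_eval_closed[of "[thompson_x0, thompson_x1, h]" 3] by simp
  define r where "r = word_eval thompson_F [thompson_x0, thompson_x1, \<one>\<^bsub>thompson_F\<^esub>] w s"
  have r: "r \<in> {0..1}" "r < 1"
    unfolding r_def using thompson_range[OF closed s01, of "\<one>\<^bsub>thompson_F\<^esub>"]
      thompson_less_iff[OF closed s01, of "\<one>\<^bsub>thompson_F\<^esub>" 1] thompson_ends(2)[OF closed, of "\<one>\<^bsub>thompson_F\<^esub>"] s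
    by auto
  have "\<forall>\<^sub>F n in sequentially. r < \<tau> n"
    using order_tendstoD(1)[OF \<tau> r(2)] .
  with id Cons.IH[OF w, folded r_def] show ?case
  proof eventually_elim
    case (elim n)
    have gr: "g n r = r"
      using elim(1,3) r by simp
    have gr': "(inv\<^bsub>thompson_F\<^esub> (g n)) r = r"
      using thompson_inv_apply(2)[OF g r(1), of n] gr by simp
    show ?case
      using i closed[OF g] closed[OF TF.one_closed] g s01 elim(2) r gr gr' r_def[symmetric]
      by (auto simp: thompson_mult_apply thompson_one_apply)
  qed
qed simp

text \<open>The support condition settles the points below \<open>\<tau>\<close>, and the two
  endpoints of the linear piece force slope 2 and constant -1.\<close>

lemma x1_likeI:
  assumes y: "y \<in> carrier thompson_F" and \<tau>: "\<tau> \<in> {1/2..<1}"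
    and supp: "thompson_support y \<subseteq> {\<tau>..1}"
    and lin: "maps_linearly_onto y {(3 + \<tau>) / 4..1} {(1 + \<tau>) / 2..1}"
  shows "x1_like \<tau> y"
proof -
  have id: "y s = s" if "s \<in> {0..<\<tau>}" for s
  proof (rule ccontr)
    assume "y s \<noteq> s"
    then have "s \<in> thompson_support y"
      unfolding thompson_support_def using that \<tau> by (intro subsetD[OF closure_subset]) auto
    then show False
      using supp that by auto
  qed
  have \<tau>01: "\<tau> \<in> {0..1}"
    using \<tau> by simp
  \<comment> \<open>The support may contain \<open>\<tau>\<close>, so this point is treated
    separately. A value below \<open>\<tau>\<close> violates monotonicity; a value above it leaves a
    gap in the range of \<open>y\<close>.\<close>
  have id\<tau>: "y \<tau> = \<tau>"
  proof (rule ccontr)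
    assume "y \<tau> \<noteq> \<tau>"
    then consider "y \<tau> < \<tau>" | "\<tau> < y \<tau>"
      by linarith
    then show False
    proof cases
      case 1
      define s where "s = (y \<tau> + \<tau>) / 2"
      have s: "y \<tau> < s" "s < \<tau>" "0 \<le> s"
        using 1 thompson_range[OF y \<tau>01] by (auto simp: s_def)
      then show False
        using id[of s] thompson_less_iff[OF y, of s \<tau>] \<tau> by auto
    next
      case 2
      define r where "r = (y \<tau> + \<tau>) / 2"
      have r: "\<tau> < r" "r < y \<tau>" "r \<in> {0..1}"
        using 2 thompson_range[OF y \<tau>01] \<tau> by (auto simp: r_def)
      define s where "s = (inv\<^bsub>thompson_F\<^esub> y) r"
      have s: "s \<in> {0..1}" "y s = r"
        using thompson_range[OF TF.inv_closed[OF y] r(3)] thompson_inv_apply(1)[OF y r(3)]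
        by (simp_all add: s_def)
      then have "s < \<tau>"
        using thompson_less_iff[OF y s(1) \<tau>01] r by simp
      then show False
        using id[of s] s r by simp
    qed
  qed
  define l where "l = (3 + \<tau>) / 4"
  have l: "l \<in> {0..1}" "l < 1"
    using \<tau> by (auto simp: l_def)
  obtain m d where md: "\<And>s. s \<in> {l..1} \<Longrightarrow> y s = m * s + d" and img: "y ` {l..1} = {(1 + \<tau>) / 2..1}"
    using lin unfolding maps_linearly_onto_def l_def by blast
  \<comment> \<open>By monotonicity \<open>y l\<close> is the least element of the image interval,
    hence its left endpoint.\<close>
  have "y l \<in> {(1 + \<tau>) / 2..1}"
    using l unfolding img[symmetric] by auto
  moreover obtain s where s: "s \<in> {l..1}" "y s = (1 + \<tau>) / 2"
  proof -
    have "(1 + \<tau>) / 2 \<in> y ` {l..1}"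
      unfolding img using \<tau> by auto
    then show ?thesis
      using that by (metis imageE)
  qed
  moreover have "y l \<le> y s"
    using thompson_le_iff[OF y l(1), of s] s(1) l by auto
  ultimately have "y l = (1 + \<tau>) / 2"
    by simp
  then have l_eq: "m * l + d = (1 + \<tau>) / 2"
    using md[of l] l by simp
  have one_eq: "m + d = 1"
    using md[of 1] l thompson_ends(2)[OF y] by simp
  have "m * (3 + \<tau>) + 4 * d = 2 * (1 + \<tau>)"
    using l_eq by (simp add: l_def field_simps)
  moreover have d: "d = 1 - m"
    using one_eq by simp
  ultimately have "(m - 2) * (1 - \<tau>) = 0"
    by (simp add: algebra_simps)
  then have "m = 2"
    using \<tau> by simp
  then have "y s = 2 * s - 1" if "s \<in> {l..1}" for s
    using md[OF that] d by simp
  moreover have "y s = s" if "s \<in> {0..\<tau>}" for s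
    using id[of s] id\<tau> that by (cases "s = \<tau>") auto
  ultimately show ?thesis
    using y \<tau> unfolding x1_like_def l_def by blast
qed

section \<open>Convergence of the marked groups\<close>

theorem theorem4p3:
  fixes t :: "nat \<Rightarrow> real" and w :: "nat \<Rightarrow> word"
  assumes "\<And>n. n \<ge> 1 \<Longrightarrow> t n \<in> {0..<1}"
    and "t \<longlonglongrightarrow> 1"
    and "\<And>n. n \<ge> 1 \<Longrightarrow> w n \<in> words 2"
    and "\<And>n. n \<ge> 1 \<Longrightarrow> thompson_support (thompson_eval (w n)) \<subseteq> {t n..1}"
    and "\<And>n. n \<ge> 1 \<Longrightarrow>
           maps_linearly_onto (thompson_eval (w n)) {(3 + t n) / 4..1} {(1 + t n) / 2..1}"
  shows "limitin (marked_topology 3)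
           (\<lambda>n. marked_class 3 (presented_group 3 (thompson_relators wa wb \<union> {winv wc @ w n})))
           (marked_class 3 (presented_group 3
              (thompson_relators wa wb \<union> thompson_relators wa wc \<union>
               {wcomm (wb @ wpow wa (-1)) (wpow wa i @ wc @ wpow wa (- i)) | i. True})))
           sequentially"
proof -
  let ?F = thompson_F and ?x0 = thompson_x0 and ?x1 = thompson_x1
  define R where "R n = thompson_relators wa wb \<union> {winv wc @ w n}" for n
  define R' where "R' = thompson_relators wa wb \<union> thompson_relators wa wc \<union>
    {wcomm (wb @ wpow wa (-1)) (wpow wa i @ wc @ wpow wa (- i)) | i. True}"
  \<comment> \<open>The hypotheses start at index 1; \<open>max n 1\<close> keeps \<open>g n\<close>
    in F for every \<open>n\<close>.\<close>
  define g where "g n = thompson_eval (w (max n 1))" for n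
  have g: "g n \<in> carrier ?F" for n
    using assms(3)[of "max n 1"] TF.word_eval_closed[of "[?x0, ?x1]" 2]
    by (simp add: g_def thompson_eval_def)
  have R_words: "R n \<subseteq> words 3" if "n \<ge> 1" for n
  proof -
    have "u \<in> words 3" if "u \<in> words 2" for u
      using that by (induction u) auto
    then show ?thesis
      using assms(3)[OF that] thompson_relators_words[of wa 3 wb] by (auto simp: R_def)
  qed
  have R'_words: "R' \<subseteq> words 3"
    using thompson_relators_words[of wa 3 wb] thompson_relators_words[of wa 3 wc]
    by (auto simp: R'_def intro!: wcomm_words simp: wpow_words)
  have S: "length [?x0, ?x1, g n] = 3" "set [?x0, ?x1, g n] \<subseteq> carrier ?F" for n
    using g by auto
  have g_like: "\<forall>\<^sub>F n in sequentially. x1_like (t n) (g n)"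
    using order_tendstoD(1)[OF assms(2), of "1/2", simplified] eventually_ge_at_top[of 1]
  proof eventually_elim
    case (elim n)
    then show ?case
      using g[of n] assms(1,4,5)[of n] by (intro x1_likeI) (auto simp: g_def max_def)
  qed
  have g_id: "\<forall>\<^sub>F n in sequentially. \<forall>s\<in>{0..t n}. g n s = s"
    using g_like by eventually_elim (simp add: x1_like_def)
  \<comment> \<open>The last relator expresses \<open>c\<close> as a word in \<open>a\<close> and
    \<open>b\<close>, so this identifies the marked group with F marked by x_0, x_1 and w_n.\<close>
  have G_n: "u \<in> marked_relations 3 (presented_group 3 (R n)) \<longleftrightarrow>
      word_eval ?F [?x0, ?x1, g n] u = \<one>\<^bsub>?F\<^esub>" if n: "n \<ge> 1" and u: "u \<in> words 3" for n u
  proof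
    have w_n: "w n \<in> words 2" "word_eval ?F [?x0, ?x1] (w n) = g n"
      using assms(3)[OF n] n by (simp_all add: g_def thompson_eval_def max_def)
    show "word_eval ?F [?x0, ?x1, g n] u = \<one>\<^bsub>?F\<^esub>"
      if rel: "u \<in> marked_relations 3 (presented_group 3 (R n))"
    proof -
      have "word_eval ?F [?x0, ?x1, g n] r = \<one>\<^bsub>?F\<^esub>" if "r \<in> R n" for r
      proof (cases "r \<in> thompson_relators wa wb")
        case True
        then show ?thesis
          using TF.thompson_relators_iff[OF S, of 0 1 n] x1_like_pair[OF x1_like_x1] by simp
      next
        case False
        then have "r = winv wc @ w n"
          using that by (auto simp: R_def)
        moreover have "word_eval ?F [?x0, ?x1, g n] (w n) = word_eval ?F [?x0, ?x1] (w n)"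
          by (rule TF.word_eval_cong[OF w_n(1)]) (auto simp: less_2_cases_iff)
        ultimately show ?thesis
          using g w_n(2) by simp
      qed
      \<comment> \<open>The family is constant in \<open>m\<close>, which is the case of von Dyck's
        theorem.\<close>
      then have "\<forall>\<^sub>F m in sequentially. word_eval ?F [?x0, ?x1, g n] u = \<one>\<^bsub>?F\<^esub>"
        by (intro eventually_presented_relation[OF TF.is_group S R_words[OF n] _ rel]) simp
      then show ?thesis
        by (simp add: eventually_const)
    qed
    show "u \<in> marked_relations 3 (presented_group 3 (R n))"
      if triv: "word_eval ?F [?x0, ?x1, g n] u = \<one>\<^bsub>?F\<^esub>"
    proof -
      obtain A a b c where A: "presented_group 3 (R n) = (A, [a, b, c])" "group A"
        "a \<in> carrier A" "b \<in> carrier A" "c \<in> carrier A"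
        "\<And>r. r \<in> R n \<Longrightarrow> word_eval A [a, b, c] r = \<one>\<^bsub>A\<^esub>"
        using presented_group_3[OF R_words[OF n]] by metis
      interpret A: group A by fact
      have pair: "thompson_pair A a b"
        using A.thompson_relators_iff[of "[a, b, c]" 3 0 1] A(3-6) by (simp add: R_def)
      have eq: "word_eval A [a, b, c] (w n) = word_eval A [a, b] (w n)"
        by (rule A.word_eval_cong[OF w_n(1)]) (auto simp: less_2_cases_iff)
      have closed: "word_eval A [a, b] (w n) \<in> carrier A"
        using A.word_eval_closed[of "[a, b]" 2 "w n"] A(3,4) w_n(1) by simp
      have "inv\<^bsub>A\<^esub> c \<otimes>\<^bsub>A\<^esub> word_eval A [a, b] (w n) = \<one>\<^bsub>A\<^esub>"
        using A(6)[of "winv wc @ w n"] A(3-5) eq by (simp add: R_def)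
      then have c: "word_eval A [a, b] (w n) = c"
        using closed A(5) by (metis A.inv_equality A.inv_closed A.inv_inv A.inv_comm)
      have "word_eval A (map (word_eval A [a, b]) [wa, wb, w n]) u = \<one>\<^bsub>A\<^esub>"
        using triv w_n u
        by (intro thompson_presentation_subst[OF pair x1_like_x1]) (simp_all add: numeral_3_eq_3)
      then show ?thesis
        using u c A(3-5) by (simp add: marked_relations_def A(1))
    qed
  qed
  have G: "\<forall>\<^sub>F n in sequentially. word_eval ?F [?x0, ?x1, g n] u = \<one>\<^bsub>?F\<^esub>"
    if u: "u \<in> marked_relations 3 (presented_group 3 R')" for u
  proof (rule eventually_presented_relation[OF TF.is_group S R'_words _ u])
    fix r assume "r \<in> R'"
    then consider "r \<in> thompson_relators wa wb" | "r \<in> thompson_relators wa wc"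
      | i where "r = wcomm (wb @ wpow wa (-1)) (wpow wa i @ wc @ wpow wa (- i))"
      by (auto simp: R'_def)
    then show "\<forall>\<^sub>F n in sequentially. word_eval ?F [?x0, ?x1, g n] r = \<one>\<^bsub>?F\<^esub>"
    proof cases
      case 1
      then have "word_eval ?F [?x0, ?x1, g n] r = \<one>\<^bsub>?F\<^esub>" for n
        using TF.thompson_relators_iff[OF S, of 0 1 n] x1_like_pair[OF x1_like_x1] by simp
      then show ?thesis
        by simp
    next
      case 2
      from g_like show ?thesis
      proof eventually_elim
        case (elim n)
        then show ?case
          using TF.thompson_relators_iff[OF S, of 0 2 n] x1_like_pair 2 by simp
      qed
    next
      case 3
      \<comment> \<open>The quotient of x_1 by x_0 fixes \<open>{3/4..1}\<close>. The conjugate of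
        \<open>g n\<close> by \<open>f\<close> fixes \<open>{0..3/4}\<close> once \<open>t n\<close>
        exceeds the preimage \<open>h (3/4)\<close> of 3/4; this bound depends on
        \<open>i\<close>.\<close>
      define f where "f = ?x0 [^]\<^bsub>?F\<^esub> i"
      have f: "f \<in> carrier ?F"
        by (simp add: f_def)
      define h where "h = inv\<^bsub>?F\<^esub> f"
      have h: "h \<in> carrier ?F" "inv\<^bsub>?F\<^esub> h = f"
        using f by (simp_all add: h_def)
      have "h (3/4) < 1"
        using thompson_less_iff[OF h(1), of "3/4" 1] thompson_ends(2)[OF h(1)] by simp
      from order_tendstoD(1)[OF assms(2) this] g_id show ?thesis
      proof eventually_elim
        case (elim n)
        have conj: "(f \<otimes>\<^bsub>?F\<^esub> g n \<otimes>\<^bsub>?F\<^esub> h) s = s" if s: "s \<in> {0..3/4}" for s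
        proof -
          have s01: "s \<in> {0..1}"
            using s by simp
          have "h s \<le> h (3/4)"
            using thompson_le_iff[OF h(1) s01, of "3/4"] s by simp
          then have "h s \<in> {0..t n}"
            using thompson_range[OF h(1) s01] elim(1) by simp
          then show ?thesis
            using thompson_conj_apply[OF h(1) g s01] elim(2) h(2) by simp
        qed
        have "(?x1 \<otimes>\<^bsub>?F\<^esub> inv\<^bsub>?F\<^esub> ?x0) \<otimes>\<^bsub>?F\<^esub> (f \<otimes>\<^bsub>?F\<^esub> g n \<otimes>\<^bsub>?F\<^esub> h) =
            (f \<otimes>\<^bsub>?F\<^esub> g n \<otimes>\<^bsub>?F\<^esub> h) \<otimes>\<^bsub>?F\<^esub> (?x1 \<otimes>\<^bsub>?F\<^esub> inv\<^bsub>?F\<^esub> ?x0)"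
          using x1_like_mult_inv_x0[OF x1_like_x1] conj f g h
          by (intro thompson_commute[of _ _ "3/4"]) auto
        then show ?case
          using TF.conj_relator_iff[OF S, of 0 1 2 n i] 3 by (simp add: f_def h_def)
      qed
    qed
  qed
  obtain A a b c where A: "presented_group 3 R' = (A, [a, b, c])" "group A"
    "a \<in> carrier A" "b \<in> carrier A" "c \<in> carrier A"
    "\<And>r. r \<in> R' \<Longrightarrow> word_eval A [a, b, c] r = \<one>\<^bsub>A\<^esub>"
    using presented_group_3[OF R'_words] by metis
  interpret A: group A by fact
  have pairs: "thompson_pair A a b" "thompson_pair A a c"
    using A.thompson_relators_iff[of "[a, b, c]" 3 0 1] A.thompson_relators_iff[of "[a, b, c]" 3 0 2]
      A(3-6) by (simp_all add: R'_def)
  \<comment> \<open>With \<open>b = a\<close> the relators are trivial. This allows \<open>b\<close>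
    to be specialised to \<open>a\<close> below.\<close>
  have pair_a: "thompson_pair A a a"
    using A(3) by unfold_locales (simp_all add: A.m_assoc)
  have split: "word_eval A [a, b, c] u =
      word_eval A [a, b, \<one>\<^bsub>A\<^esub>] u \<otimes>\<^bsub>A\<^esub> inv\<^bsub>A\<^esub> (word_eval A [a, a, \<one>\<^bsub>A\<^esub>] u) \<otimes>\<^bsub>A\<^esub> word_eval A [a, a, c] u"
    if "u \<in> words 3" for u
  proof (rule A.word_eval_split[OF A(3-5) _ that])
    fix i :: int
    have "wcomm (wb @ wpow wa (-1)) (wpow wa i @ wc @ wpow wa (- i)) \<in> R'"
      by (auto simp: R'_def)
    then show "(b \<otimes>\<^bsub>A\<^esub> inv\<^bsub>A\<^esub> a) \<otimes>\<^bsub>A\<^esub> (a [^]\<^bsub>A\<^esub> i \<otimes>\<^bsub>A\<^esub> c \<otimes>\<^bsub>A\<^esub> inv\<^bsub>A\<^esub> (a [^]\<^bsub>A\<^esub> i)) =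
        (a [^]\<^bsub>A\<^esub> i \<otimes>\<^bsub>A\<^esub> c \<otimes>\<^bsub>A\<^esub> inv\<^bsub>A\<^esub> (a [^]\<^bsub>A\<^esub> i)) \<otimes>\<^bsub>A\<^esub> (b \<otimes>\<^bsub>A\<^esub> inv\<^bsub>A\<^esub> a)"
      using A.conj_relator_iff[of "[a, b, c]" 3 0 1 2 i] A(3-6) by simp
  qed
  have frequently_trivial: "u \<in> marked_relations 3 (presented_group 3 R')"
    if u: "u \<in> words 3" and freq: "\<exists>\<^sub>F n in sequentially. word_eval ?F [?x0, ?x1, g n] u = \<one>\<^bsub>?F\<^esub>" for u
  proof -
    have closed: "word_eval ?F [?x0, ?x1, h] u \<in> carrier ?F" if "h \<in> carrier ?F" for h
      using TF.word_eval_closed[of "[?x0, ?x1, h]" 3] u that by simp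
    \<comment> \<open>The index \<open>n\<close> may depend on the point \<open>s\<close>:
      infinitely many \<open>n\<close> make the word trivial, and for almost all \<open>n\<close>
      its value at \<open>s\<close> is that with \<open>c\<close> replaced by 1.\<close>
    have triv: "word_eval ?F [?x0, ?x1, \<one>\<^bsub>?F\<^esub>] u = \<one>\<^bsub>?F\<^esub>"
    proof (rule thompson_eqI)
      fix s :: real assume s: "s \<in> {0..<1}"
      obtain n where "word_eval ?F [?x0, ?x1, g n] u = \<one>\<^bsub>?F\<^esub>"
        "word_eval ?F [?x0, ?x1, g n] u s = word_eval ?F [?x0, ?x1, \<one>\<^bsub>?F\<^esub>] u s"
        using frequently_ex[OF frequently_eventually_conj[OF freq
              eventually_word_eval_apply[OF assms(2) g g_id u s]]] by blast
      then show "word_eval ?F [?x0, ?x1, \<one>\<^bsub>?F\<^esub>] u s = \<one>\<^bsub>?F\<^esub> s"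
        by simp
    qed (use closed in auto)
    \<comment> \<open>Taking \<open>\<beta>\<close> to be \<open>b\<close> and then \<open>a\<close>
      makes the first two factors of \<open>split\<close> trivial.\<close>
    have ab: "word_eval A [a, \<beta>, \<one>\<^bsub>A\<^esub>] u = \<one>\<^bsub>A\<^esub>" if "thompson_pair A a \<beta>" "\<beta> \<in> carrier A" for \<beta>
    proof -
      have "word_eval A (map (word_eval A [a, \<beta>]) [wa, wb, []]) u = \<one>\<^bsub>A\<^esub>"
        using triv u by (intro thompson_presentation_subst[OF that(1) x1_like_x1]) (simp_all add: numeral_3_eq_3)
      then show ?thesis
        using A(3) that by simp
    qed
    have S': "length [a, b, c] = 3" "set [a, b, c] \<subseteq> carrier A"
      using A(3-5) by simp_all
    have closed_A: "word_eval A [a, a, c] u \<in> carrier A"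
      using A.word_eval_closed[of "[a, a, c]" 3] A(3,5) u by simp
    have u_eq: "word_eval A [a, b, c] u = word_eval A [a, a, c] u"
      using split[OF u] ab[OF pairs(1)] ab[OF pair_a] A(3,4) closed_A by simp
    \<comment> \<open>Substituting \<open>a\<close> for \<open>b\<close> turns the identity
      \<open>u_eq\<close> into a relation in the generators of the limit group, to which
      \<open>G\<close> applies.\<close>
    define u' where "u' = word_subst [wa, wa, wc] u"
    have u': "u' \<in> words 3"
      unfolding u'_def using u by (intro word_subst_words) (simp_all add: numeral_3_eq_3)
    have u'_A: "word_eval A [a, b, c] u' = word_eval A [a, a, c] u"
      using A.word_eval_subst[OF S', of "[wa, wa, wc]" u] u A(3-5) by (simp add: u'_def numeral_3_eq_3)
    have "winv u @ u' \<in> marked_relations 3 (presented_group 3 R')"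
      using u u' u_eq u'_A closed_A
      by (simp add: marked_relations_def A(1) A.word_eval_append[OF S'] A.word_eval_winv[OF S'])
    \<comment> \<open>A single suitable \<open>n\<close> is enough: \<open>u\<close> is trivial
      infinitely often, the other two properties hold from some index on.\<close>
    from frequently_eventually_conj[OF freq eventually_conj[OF G[OF this] g_like]]
    obtain n where n: "word_eval ?F [?x0, ?x1, g n] u = \<one>\<^bsub>?F\<^esub>"
      "word_eval ?F [?x0, ?x1, g n] (winv u @ u') = \<one>\<^bsub>?F\<^esub>" "x1_like (t n) (g n)"
      using frequently_ex by blast
    have u'_F: "word_eval ?F [?x0, ?x1, g n] u' = word_eval ?F [?x0, ?x0, g n] u"
      using TF.word_eval_subst[OF S, of "[wa, wa, wc]" u n] u g by (simp add: u'_def numeral_3_eq_3)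
    have "word_eval ?F [?x0, ?x0, g n] u \<in> carrier ?F"
      using TF.word_eval_closed[OF S u', of n] unfolding u'_F .
    then have "word_eval ?F [?x0, ?x0, g n] u = \<one>\<^bsub>?F\<^esub>"
      using n(1,2) u u' u'_F
      by (simp add: TF.word_eval_append[OF S] TF.word_eval_winv[OF S])
    \<comment> \<open>Here the role of x_1 is played by \<open>g n\<close>, and the pair in the
      limit group is \<open>a\<close> and \<open>c\<close>, so the letter \<open>wb\<close> stands
      for \<open>c\<close>.\<close>
    then have "word_eval A (map (word_eval A [a, c]) [wa, wa, wb]) u = \<one>\<^bsub>A\<^esub>"
      using u g by (intro thompson_presentation_subst[OF pairs(2) n(3)]) (simp_all add: numeral_3_eq_3)
    then have "word_eval A [a, a, c] u = \<one>\<^bsub>A\<^esub>"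
      using A(3,5) by simp
    then show ?thesis
      using u u_eq by (simp add: marked_relations_def A(1))
  qed
  have "limitin (marked_topology 3) (\<lambda>n. marked_class 3 (presented_group 3 (R n)))
      (marked_class 3 (presented_group 3 R')) sequentially"
  proof (rule limitin_marked_class)
    show "presented_group 3 R' \<in> marked_groups 3"
      by (rule presented_group_marked[OF R'_words])
    show "\<forall>\<^sub>F n in sequentially. presented_group 3 (R n) \<in> marked_groups 3"
      using eventually_ge_at_top[of 1]
      by eventually_elim (rule presented_group_marked[OF R_words])
    fix u assume u: "u \<in> words 3"
    \<comment> \<open>A relation of the limit is eventually a relation; a word that is none is
      trivial only finitely often, by the contrapositive of
      \<open>frequently_trivial\<close>.\<close>
    have "\<forall>\<^sub>F n in sequentially. word_eval ?F [?x0, ?x1, g n] u = \<one>\<^bsub>?F\<^esub> \<longleftrightarrow>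
        u \<in> marked_relations 3 (presented_group 3 R')"
    proof (cases "u \<in> marked_relations 3 (presented_group 3 R')")
      case True
      then show ?thesis
        using G by simp
    next
      case False
      then have "\<not> (\<exists>\<^sub>F n in sequentially. word_eval ?F [?x0, ?x1, g n] u = \<one>\<^bsub>?F\<^esub>)"
        using frequently_trivial[OF u] by blast
      then show ?thesis
        using False by (simp add: not_frequently)
    qed
    then show "\<forall>\<^sub>F n in sequentially. u \<in> marked_relations 3 (presented_group 3 (R n)) \<longleftrightarrow>
        u \<in> marked_relations 3 (presented_group 3 R')"
      using eventually_ge_at_top[of 1] by eventually_elim (use G_n[OF _ u] in blast)
  qed
  then show ?thesis
    unfolding R_def R'_def .
qed

end
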